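(* Let $\Lambda\ge\lambda>0$ and set $\omega=\Lambda/\lambda\ge 1$. For $\frac{1}{\sqrt\omega}\le\gamma\le\sqrt\omega$ define the even function $\phi^\omega_\gamma$ on $|x|\le \frac{\pi}{2}+\sqrt\omega\arcsin\left(\frac{1}{\gamma\sqrt\omega}\right)$ by $$\phi^\omega_\gamma(x)=\begin{cases}\frac{\pi}{2}+\sqrt\omega\arcsin\left(\frac{\gamma}{\sqrt\omega}\cos x\right) & |x|\le\frac{\pi}{2},\\[1ex] \arccos\left(\gamma\sqrt\omega\,\sin\left(\frac{|x|-\pi/2}{\sqrt\omega}\right)\right) & \frac{\pi}{2}<|x|\le\frac{\pi}{2}+\sqrt\omega\arcsin\left(\frac{1}{\gamma\sqrt\omega}\right),\end{cases}$$ and let $\Omega^\omega_\gamma=\{(x,y)\in\mathbb{R}^2: |y|<\phi^\omega_\gamma(x)\}$. Then the positive principal eigenvalue of $\mathcal{M}^+_{\lambda,\Lambda}$ in $\Omega^\omega_\gamma$ is $\mu(\Omega^\omega_\gamma)=\lambda$, and the principal eigenfunction is, up to positive multiplicative constants, $$u^\omega_\gamma(x,y)=\begin{cases}\gamma\cos x+\cos y & |x|\le\frac{\pi}{2},\ |y|\le\frac{\pi}{2},\\[1ex] \gamma\sqrt\omega\cos\left(\frac{|x|-\pi/2}{\sqrt\omega}+\frac{\pi}{2}\right)+\cos y & (x,y)\in\Omega^\omega_\gamma,\ |x|\ge\frac{\pi}{2},\\[1ex] \gamma\cos x+\sqrt\omega\cos\left(\frac{|y|-\pi/2}{\sqrt\omega}+\frac{\pi}{2}\right)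 & (x,y)\in\Omega^\omega_\gamma,\ |y|\ge\frac{\pi}{2}.\end{cases}$$
   Context: For $0<\lambda\le\Lambda$, the Pucci supremum operator is defined on $2\times 2$ real symmetric matrices $X$ by $\mathcal{M}^+_{\lambda,\Lambda}(X)=\lambda\sum_{e_i<0}e_i+\Lambda\sum_{e_i>0}e_i$, where $e_i$ are the eigenvalues of $X$. For a bounded Lipschitz domain $\Omega$, the positive principal eigenvalue is $\mu(\Omega)=\mu^+(\Omega)=\sup\{\mu\in\mathbb{R}:\exists\,\phi>0\text{ in }\Omega,\ \mathcal{M}^+_{\lambda,\Lambda}(D^2\phi)+\mu\phi\le 0\text{ in }\Omega\}$ (in the viscosity sense); a principal eigenfunction is a $\phi>0$ in $\Omega$ with $\mathcal{M}^+_{\lambda,\Lambda}(D^2\phi)+\mu(\Omega)\phi=0$ in $\Omega$, $\phi=0$ on $\partial\Omega$. *)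

theory Defs
  imports "HOL-Analysis.Analysis"
begin

text \<open>Points of the plane are pairs (x,y) :: real \<times> real.
  A symmetric 2x2 matrix [[a,b],[b,c]] is represented by its entries a, b, c.\<close>

definition eig_hi :: "real \<Rightarrow> real \<Rightarrow> real \<Rightarrow> real" where
  "eig_hi a b c = (a + c) / 2 + sqrt (((a - c) / 2)\<^sup>2 + b\<^sup>2)"

definition eig_lo :: "real \<Rightarrow> real \<Rightarrow> real \<Rightarrow> real" where
  "eig_lo a b c = (a + c) / 2 - sqrt (((a - c) / 2)\<^sup>2 + b\<^sup>2)"

definition pucci_plus :: "real \<Rightarrow> real \<Rightarrow> real \<Rightarrow> real \<Rightarrow> real \<Rightarrow> real" where
  "pucci_plus lam Lam a b c =
     lam * (min (eig_hi a b c) 0 + min (eig_lo a b c) 0)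
   + Lam * (max (eig_hi a b c) 0 + max (eig_lo a b c) 0)"

definition C2_hess_at :: "(real \<times> real \<Rightarrow> real) \<Rightarrow> real \<times> real \<Rightarrow> real \<Rightarrow> real \<Rightarrow> real \<Rightarrow> bool" where
  "C2_hess_at \<psi> z0 a b c \<longleftrightarrow>
     (\<exists>U g H. open U \<and> z0 \<in> U \<and>
        (\<forall>z\<in>U. (\<psi> has_derivative (\<lambda>h. g z \<bullet> h)) (at z)) \<and>
        (\<forall>z\<in>U. (g has_derivative H z) (at z)) \<and>
        continuous_on U (\<lambda>z. H z (1, 0)) \<and> continuous_on U (\<lambda>z. H z (0, 1)) \<and>
        a = fst (H z0 (1, 0)) \<and> b = snd (H z0 (1, 0)) \<and> c = snd (H z0 (0, 1)))"

definition visc_super :: "real \<Rightarrow> real \<Rightarrow> real \<Rightarrow> (real \<times> real) set \<Rightarrow> (real \<times> real \<Rightarrow> real) \<Rightarrow> bool" where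
  "visc_super lam Lam \<mu> \<Omega> \<phi> \<longleftrightarrow>
     (\<forall>z0\<in>\<Omega>. \<forall>\<psi> a b c. C2_hess_at \<psi> z0 a b c \<and> \<psi> z0 = \<phi> z0 \<and>
        eventually (\<lambda>z. \<psi> z \<le> \<phi> z) (at z0)
        \<longrightarrow> pucci_plus lam Lam a b c + \<mu> * \<phi> z0 \<le> 0)"

definition visc_sub :: "real \<Rightarrow> real \<Rightarrow> real \<Rightarrow> (real \<times> real) set \<Rightarrow> (real \<times> real \<Rightarrow> real) \<Rightarrow> bool" where
  "visc_sub lam Lam \<mu> \<Omega> \<phi> \<longleftrightarrow>
     (\<forall>z0\<in>\<Omega>. \<forall>\<psi> a b c. C2_hess_at \<psi> z0 a b c \<and> \<psi> z0 = \<phi> z0 \<and>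
        eventually (\<lambda>z. \<psi> z \<ge> \<phi> z) (at z0)
        \<longrightarrow> pucci_plus lam Lam a b c + \<mu> * \<phi> z0 \<ge> 0)"

definition principal_eigenvalue :: "real \<Rightarrow> real \<Rightarrow> (real \<times> real) set \<Rightarrow> real" where
  "principal_eigenvalue lam Lam \<Omega> =
     Sup {\<mu>. \<exists>\<phi>. continuous_on \<Omega> \<phi> \<and> (\<forall>z\<in>\<Omega>. \<phi> z > 0) \<and> visc_super lam Lam \<mu> \<Omega> \<phi>}"

definition principal_eigenfunction :: "real \<Rightarrow> real \<Rightarrow> (real \<times> real) set \<Rightarrow> (real \<times> real \<Rightarrow> real) \<Rightarrow> bool" where
  "principal_eigenfunction lam Lam \<Omega> \<phi> \<longleftrightarrow>
     continuous_on (closure \<Omega>) \<phi> \<and> (\<forall>z\<in>\<Omega>. \<phi> z > 0) \<and> (\<forall>z\<in>frontier \<Omega>. \<phi> z = 0) \<and>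
     visc_super lam Lam (principal_eigenvalue lam Lam \<Omega>) \<Omega> \<phi> \<and>
     visc_sub lam Lam (principal_eigenvalue lam Lam \<Omega>) \<Omega> \<phi>"

definition phi_bound :: "real \<Rightarrow> real \<Rightarrow> real" where
  "phi_bound \<omega> \<gamma> = pi / 2 + sqrt \<omega> * arcsin (1 / (\<gamma> * sqrt \<omega>))"

definition phi_prof :: "real \<Rightarrow> real \<Rightarrow> real \<Rightarrow> real" where
  "phi_prof \<omega> \<gamma> x =
     (if \<bar>x\<bar> \<le> pi / 2 then pi / 2 + sqrt \<omega> * arcsin (\<gamma> / sqrt \<omega> * cos x)
      else arccos (\<gamma> * sqrt \<omega> * sin ((\<bar>x\<bar> - pi / 2) / sqrt \<omega>)))"

definition Omega_dom :: "real \<Rightarrow> real \<Rightarrow> (real \<times> real) set" where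
  "Omega_dom \<omega> \<gamma> = {(x, y). \<bar>x\<bar> \<le> phi_bound \<omega> \<gamma> \<and> \<bar>y\<bar> < phi_prof \<omega> \<gamma> x}"

definition u_eig :: "real \<Rightarrow> real \<Rightarrow> real \<times> real \<Rightarrow> real" where
  "u_eig \<omega> \<gamma> z = (let x = fst z; y = snd z in
     if \<bar>x\<bar> \<le> pi / 2 \<and> \<bar>y\<bar> \<le> pi / 2 then \<gamma> * cos x + cos y
     else if \<bar>x\<bar> \<ge> pi / 2 then
       \<gamma> * sqrt \<omega> * cos ((\<bar>x\<bar> - pi / 2) / sqrt \<omega> + pi / 2) + cos y
     else \<gamma> * cos x + sqrt \<omega> * cos ((\<bar>y\<bar> - pi / 2) / sqrt \<omega> + pi / 2))"

end

theory Submission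
  imports Defs
begin

text \<open>Put \<open>s = \<surd>\<omega>\<close>. The candidate separates as \<open>U(x, y) = \<gamma> f(x) + f(y)\<close> with one C2 profile \<open>f\<close>, equal to
  \<open>cos t\<close> for \<open>\<bar>t\<bar> \<le> \<pi>/2\<close> and to \<open>- s sin ((\<bar>t\<bar> - \<pi>/2) / s)\<close> beyond. Both the switch of \<open>f''\<close> from
  \<open>- f\<close> to \<open>- f / \<omega>\<close> and the switch of the Pucci coefficient from \<open>\<lambda>\<close> to \<open>\<Lambda>\<close> happen at \<open>\<bar>t\<bar> = \<pi>/2\<close>, so \<open>U\<close>
  is a classical solution with eigenvalue \<open>\<lambda>\<close>, and the domain is the positivity set of \<open>U\<close>.

  The domain is strictly star-shaped, so \<open>U(R z)\<close> with \<open>R > 1\<close> is a positive subsolution for the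
  eigenvalue \<open>R\<^sup>2 \<lambda>\<close> on a compact part of it; scaling it until it touches a positive supersolution
  from below gives \<open>\<mu> \<le> R\<^sup>2 \<lambda>\<close>.

  For uniqueness, a strict positive supersolution near the boundary extends \<open>\<phi> \<ge> t U\<close> from a
  compact set \<open>K\<close> to the whole domain, where \<open>t\<close> is the minimum of \<open>\<phi> / U\<close> on \<open>K\<close>; contact at a point
  of \<open>K\<close> and the strong maximum principle give \<open>\<phi> = t U\<close>.\<close>

section \<open>The Pucci operator\<close>

text \<open>The eigenvalues sum to the trace, so the sum of their positive parts is the largest of
  0, the larger eigenvalue and the trace. The operator thus becomes \<open>lam\<close> times the
  trace plus a nonnegative multiple of a convex, positively homogeneous function.\<close>

lemma pucci_plus_eq:
  assumes "lam \<le> Lam"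
  shows "pucci_plus lam Lam a b c =
    lam * (a + c) + (Lam - lam) * max 0 (max (eig_hi a b c) (a + c))"
proof -
  have sum: "eig_hi a b c + eig_lo a b c = a + c"
    by (simp add: eig_hi_def eig_lo_def)
  have le: "eig_lo a b c \<le> eig_hi a b c"
    by (simp add: eig_hi_def eig_lo_def)
  have pos: "max (eig_hi a b c) 0 + max (eig_lo a b c) 0 = max 0 (max (eig_hi a b c) (a + c))"
    using sum le by linarith
  have neg: "min (eig_hi a b c) 0 + min (eig_lo a b c) 0
      = a + c - max 0 (max (eig_hi a b c) (a + c))"
    using sum le by linarith
  show ?thesis
    unfolding pucci_plus_def pos neg by (simp add: algebra_simps)
qed

text \<open>The radical is the Euclidean norm of a vector linear in the entries, so subadditivity of
  the largest eigenvalue becomes the triangle inequality.\<close>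

lemma eig_hi_norm: "eig_hi a b c = (a + c) / 2 + norm ((a - c) / 2, b)"
  by (simp add: eig_hi_def norm_Pair power_divide)

lemma eig_hi_add: "eig_hi (a + a') (b + b') (c + c') \<le> eig_hi a b c + eig_hi a' b' c'"
proof -
  have "norm ((a + a' - (c + c')) / 2, b + b') \<le> norm ((a - c) / 2, b) + norm ((a' - c') / 2, b')"
    using norm_triangle_ineq[of "((a - c) / 2, b)" "((a' - c') / 2, b')"]
    by (simp add: diff_divide_distrib add_divide_distrib algebra_simps)
  then show ?thesis
    unfolding eig_hi_norm by (simp add: add_divide_distrib)
qed

lemma eig_hi_scale:
  assumes "0 \<le> t"
  shows "eig_hi (t * a) (t * b) (t * c) = t * eig_hi a b c"
proof -
  have "norm ((t * a - t * c) / 2, t * b) = norm (t *\<^sub>R ((a - c) / 2, b))"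
    by (simp add: algebra_simps diff_divide_distrib)
  then show ?thesis
    using assms unfolding eig_hi_norm norm_scaleR by (simp add: algebra_simps)
qed

text \<open>Subadditivity does the work of the representation as a supremum of linear operators:
  ellipticity, the contact principle and the barrier estimates all rest on it.\<close>

lemma pucci_plus_add:
  assumes "lam \<le> Lam"
  shows "pucci_plus lam Lam (a + a') (b + b') (c + c')
    \<le> pucci_plus lam Lam a b c + pucci_plus lam Lam a' b' c'"
proof -
  have "max 0 (max (eig_hi (a + a') (b + b') (c + c')) (a + a' + (c + c')))
    \<le> max 0 (max (eig_hi a b c) (a + c)) + max 0 (max (eig_hi a' b' c') (a' + c'))"
    using eig_hi_add[of a a' b b' c c'] by linarith
  then have "(Lam - lam) * max 0 (max (eig_hi (a + a') (b + b') (c + c')) (a + a' + (c + c')))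
    \<le> (Lam - lam) * (max 0 (max (eig_hi a b c) (a + c)) + max 0 (max (eig_hi a' b' c') (a' + c')))"
    using assms by (intro mult_left_mono) auto
  then show ?thesis
    unfolding pucci_plus_eq[OF assms] by (simp add: algebra_simps)
qed

lemma pucci_plus_scale:
  assumes "lam \<le> Lam" "0 \<le> t"
  shows "pucci_plus lam Lam (t * a) (t * b) (t * c) = t * pucci_plus lam Lam a b c"
proof -
  have "max 0 (max (t * eig_hi a b c) (t * a + t * c)) = t * max 0 (max (eig_hi a b c) (a + c))"
    using assms(2) by (simp add: max_mult_distrib_left algebra_simps)
  then show ?thesis
    unfolding pucci_plus_eq[OF assms(1)] eig_hi_scale[OF assms(2)]
    by (simp add: algebra_simps)
qed

lemma pucci_plus_diag:
  assumes "lam \<le> Lam"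
  shows "pucci_plus lam Lam a 0 c =
    (if a \<le> 0 then lam * a else Lam * a) + (if c \<le> 0 then lam * c else Lam * c)"
proof -
  have "eig_hi a 0 c = max a c"
    by (simp add: eig_hi_def) (simp add: max_def abs_if field_simps)
  then show ?thesis
    unfolding pucci_plus_eq[OF assms] by (simp add: max_def left_diff_distrib distrib_left)
qed

text \<open>Nonpositivity of the quadratic form expresses negative semidefiniteness. It gives
  \<open>b\<^sup>2 \<le> a * c\<close>, so the radical is at most half the absolute trace.\<close>

lemma eig_hi_nonpos_form:
  assumes "\<And>h k. a * h\<^sup>2 + 2 * b * h * k + c * k\<^sup>2 \<le> 0"
  shows "eig_hi a b c \<le> 0" "a + c \<le> 0"
proof -
  have a: "a \<le> 0" and c: "c \<le> 0"
    using assms[of 1 0] assms[of 0 1] by auto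
  then show tr: "a + c \<le> 0" by simp
  have "b\<^sup>2 \<le> a * c"
  proof (cases "a = 0")
    case True
    have "b = 0"
    proof (rule ccontr)
      assume "b \<noteq> 0"
      \<comment> \<open>For \<open>a = 0\<close> the form takes the value 1 at this vector.\<close>
      then show False
        using assms[of "(1 - c) / (2 * b)" 1] True by simp
    qed
    then show ?thesis using True by simp
  next
    case False
    \<comment> \<open>At the vector \<open>(b, - a)\<close> the form equals \<open>a\<close> times
      the determinant.\<close>
    have "a * (c * a - b\<^sup>2) \<le> 0"
      using assms[of b "- a"] by (simp add: power2_eq_square algebra_simps)
    then show ?thesis
      using False a by (simp add: mult_le_0_iff algebra_simps)
  qed
  then have "((a - c) / 2)\<^sup>2 + b\<^sup>2 \<le> ((a + c) / 2)\<^sup>2"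
    by (simp add: power2_eq_square field_simps)
  then have "sqrt (((a - c) / 2)\<^sup>2 + b\<^sup>2) \<le> \<bar>(a + c) / 2\<bar>"
    by (metis real_sqrt_abs real_sqrt_le_mono)
  then show "eig_hi a b c \<le> 0"
    unfolding eig_hi_def using tr by (simp add: field_simps)
qed

lemma pucci_plus_nonpos_form:
  assumes "lam \<le> Lam" "\<And>h k. a * h\<^sup>2 + 2 * b * h * k + c * k\<^sup>2 \<le> 0"
  shows "pucci_plus lam Lam a b c = lam * (a + c)"
  unfolding pucci_plus_eq[OF assms(1)] using eig_hi_nonpos_form[OF assms(2)]
  by (simp add: max_def)

text \<open>Ellipticity from subadditivity: M(X) \<le> M(X') + M(X - X'), and the last term is
  \<open>lam\<close> times a nonpositive trace.\<close>

lemma pucci_plus_mono: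
  assumes "0 < lam" "lam \<le> Lam"
    and "\<And>h k. (a' - a) * h\<^sup>2 + 2 * (b' - b) * h * k + (c' - c) * k\<^sup>2 \<ge> 0"
  shows "pucci_plus lam Lam a b c \<le> pucci_plus lam Lam a' b' c'"
proof -
  have neg: "(a - a') * h\<^sup>2 + 2 * (b - b') * h * k + (c - c') * k\<^sup>2 \<le> 0" for h k
    using assms(3)[of h k] by (simp add: algebra_simps)
  have "pucci_plus lam Lam (a - a') (b - b') (c - c') \<le> 0"
    using pucci_plus_nonpos_form[OF assms(2) neg] eig_hi_nonpos_form(2)[OF neg] assms(1)
    by (simp add: mult_le_0_iff)
  then show ?thesis
    using pucci_plus_add[OF assms(2), of a' "a - a'" b' "b - b'" c' "c - c'"] by simp
qed

text \<open>The form is minus \<open>k\<close> times the square of a linear form, hence nonpositive.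
  Squared-gradient terms of this shape come from differentiating Gaussians and
  \<open>U\<^sup>2\<close> twice.\<close>

lemma pucci_plus_minus_rank_one:
  assumes "lam \<le> Lam" "0 \<le> k"
  shows "pucci_plus lam Lam (- k * p\<^sup>2) (- k * p * q) (- k * q\<^sup>2) = - lam * k * (p\<^sup>2 + q\<^sup>2)"
proof -
  have "- k * p\<^sup>2 * x\<^sup>2 + 2 * (- k * p * q) * x * y + - k * q\<^sup>2 * y\<^sup>2 = - (k * (p * x + q * y)\<^sup>2)" for x y
    by (simp add: power2_eq_square algebra_simps)
  then have "- k * p\<^sup>2 * x\<^sup>2 + 2 * (- k * p * q) * x * y + - k * q\<^sup>2 * y\<^sup>2 \<le> 0" for x y
    using assms(2) by simp
  from pucci_plus_nonpos_form[OF assms(1) this] show ?thesis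
    by (simp add: algebra_simps)
qed

section \<open>Twice continuously differentiable functions of two variables\<close>

lemma C2_hess_atE:
  assumes "C2_hess_at \<psi> z0 a b c"
  obtains U g H where "open U" "z0 \<in> U"
    "\<forall>z\<in>U. (\<psi> has_derivative (\<lambda>h. g z \<bullet> h)) (at z)"
    "\<forall>z\<in>U. (g has_derivative H z) (at z)"
    "continuous_on U (\<lambda>z. H z (1, 0))" "continuous_on U (\<lambda>z. H z (0, 1))"
    "a = fst (H z0 (1, 0))" "b = snd (H z0 (1, 0))" "c = snd (H z0 (0, 1))"
  using assms unfolding C2_hess_at_def by blast

lemma C2_hess_atI:
  assumes "open U" "z0 \<in> U"
    "\<And>z. z \<in> U \<Longrightarrow> (\<psi> has_derivative (\<lambda>h. g z \<bullet> h)) (at z)"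
    "\<And>z. z \<in> U \<Longrightarrow> (g has_derivative H z) (at z)"
    "continuous_on U (\<lambda>z. H z (1, 0))" "continuous_on U (\<lambda>z. H z (0, 1))"
    "a = fst (H z0 (1, 0))" "b = snd (H z0 (1, 0))" "c = snd (H z0 (0, 1))"
  shows "C2_hess_at \<psi> z0 a b c"
  unfolding C2_hess_at_def using assms by blast

lemma C2_hess_at_add:
  assumes "C2_hess_at \<psi> z0 a b c" "C2_hess_at \<psi>' z0 a' b' c'"
  shows "C2_hess_at (\<lambda>z. \<psi> z + \<psi>' z) z0 (a + a') (b + b') (c + c')"
proof -
  from assms(1) obtain U g H where 1: "open U" "z0 \<in> U"
    "\<forall>z\<in>U. (\<psi> has_derivative (\<lambda>h. g z \<bullet> h)) (at z)"
    "\<forall>z\<in>U. (g has_derivative H z) (at z)"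
    "continuous_on U (\<lambda>z. H z (1, 0))" "continuous_on U (\<lambda>z. H z (0, 1))"
    "a = fst (H z0 (1, 0))" "b = snd (H z0 (1, 0))" "c = snd (H z0 (0, 1))"
    by (rule C2_hess_atE)
  from assms(2) obtain U' g' H' where 2: "open U'" "z0 \<in> U'"
    "\<forall>z\<in>U'. (\<psi>' has_derivative (\<lambda>h. g' z \<bullet> h)) (at z)"
    "\<forall>z\<in>U'. (g' has_derivative H' z) (at z)"
    "continuous_on U' (\<lambda>z. H' z (1, 0))" "continuous_on U' (\<lambda>z. H' z (0, 1))"
    "a' = fst (H' z0 (1, 0))" "b' = snd (H' z0 (1, 0))" "c' = snd (H' z0 (0, 1))"
    by (rule C2_hess_atE)
  show ?thesis
  proof (rule C2_hess_atI[where U = "U \<inter> U'" and g = "\<lambda>z. g z + g' z" and H = "\<lambda>z h. H z h + H' z h"])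
    show "((\<lambda>z. \<psi> z + \<psi>' z) has_derivative (\<lambda>h. (g z + g' z) \<bullet> h)) (at z)" if "z \<in> U \<inter> U'" for z
      unfolding inner_add_left using that 1 2 by (intro derivative_intros) auto
    show "((\<lambda>z. g z + g' z) has_derivative (\<lambda>h. H z h + H' z h)) (at z)" if "z \<in> U \<inter> U'" for z
      using that 1 2 by (intro derivative_intros) auto
    show "continuous_on (U \<inter> U') (\<lambda>z. H z (1, 0) + H' z (1, 0))"
      "continuous_on (U \<inter> U') (\<lambda>z. H z (0, 1) + H' z (0, 1))"
      using 1 2 by (auto intro!: continuous_on_add elim: continuous_on_subset)
  qed (use 1 2 in auto)
qed

lemma C2_hess_at_cmult:
  assumes "C2_hess_at \<psi> z0 a b c"
  shows "C2_hess_at (\<lambda>z. t * \<psi> z) z0 (t * a) (t * b) (t * c)"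
proof -
  from assms(1) obtain U g H where 1: "open U" "z0 \<in> U"
    "\<forall>z\<in>U. (\<psi> has_derivative (\<lambda>h. g z \<bullet> h)) (at z)"
    "\<forall>z\<in>U. (g has_derivative H z) (at z)"
    "continuous_on U (\<lambda>z. H z (1, 0))" "continuous_on U (\<lambda>z. H z (0, 1))"
    "a = fst (H z0 (1, 0))" "b = snd (H z0 (1, 0))" "c = snd (H z0 (0, 1))"
    by (rule C2_hess_atE)
  show ?thesis
  proof (rule C2_hess_atI[where U = U and g = "\<lambda>z. t *\<^sub>R g z" and H = "\<lambda>z h. t *\<^sub>R H z h"])
    show "((\<lambda>z. t * \<psi> z) has_derivative (\<lambda>h. (t *\<^sub>R g z) \<bullet> h)) (at z)" if "z \<in> U" for z
      unfolding inner_scaleR_left using that 1 by (intro derivative_intros) auto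
    show "((\<lambda>z. t *\<^sub>R g z) has_derivative (\<lambda>h. t *\<^sub>R H z h)) (at z)" if "z \<in> U" for z
      using that 1 by (intro derivative_intros) auto
    show "continuous_on U (\<lambda>z. t *\<^sub>R H z (1, 0))" "continuous_on U (\<lambda>z. t *\<^sub>R H z (0, 1))"
      using 1 by (auto intro!: continuous_intros)
  qed (use 1 in auto)
qed

lemma C2_hess_at_diff:
  assumes "C2_hess_at \<psi> z0 a b c" "C2_hess_at \<psi>' z0 a' b' c'"
  shows "C2_hess_at (\<lambda>z. \<psi> z - \<psi>' z) z0 (a - a') (b - b') (c - c')"
  using C2_hess_at_add[OF assms(1) C2_hess_at_cmult[OF assms(2), of "-1"]] by simp

text \<open>The explicit functions of the proof, Gaussians and squares included, are assembled from
  such products by sums and scalar multiples.\<close>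

lemma C2_hess_at_prod:
  fixes F G :: "real \<Rightarrow> real"
  assumes F: "\<And>x. (F has_real_derivative F' x) (at x)" "\<And>x. (F' has_real_derivative F'' x) (at x)"
      "continuous_on UNIV F''"
    and G: "\<And>x. (G has_real_derivative G' x) (at x)" "\<And>x. (G' has_real_derivative G'' x) (at x)"
      "continuous_on UNIV G''"
  shows "C2_hess_at (\<lambda>z. F (fst z) * G (snd z)) (x, y) (F'' x * G y) (F' x * G' y) (F x * G'' y)"
proof -
  note d = DERIV_compose_FDERIV[OF F(1)] DERIV_compose_FDERIV[OF F(2)]
    DERIV_compose_FDERIV[OF G(1)] DERIV_compose_FDERIV[OF G(2)]
  have cont: "continuous_on UNIV F" "continuous_on UNIV F'" "continuous_on UNIV G" "continuous_on UNIV G'"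
    by (meson F G DERIV_isCont continuous_at_imp_continuous_on)+
  note c = this[THEN continuous_on_compose2] F(3)[THEN continuous_on_compose2] G(3)[THEN continuous_on_compose2]
  show ?thesis
  proof (rule C2_hess_atI[where U = UNIV
        and g = "\<lambda>z. (F' (fst z) * G (snd z), F (fst z) * G' (snd z))"
        and H = "\<lambda>z h. (F' (fst z) * (snd h * G' (snd z)) + fst h * F'' (fst z) * G (snd z),
                        F (fst z) * (snd h * G'' (snd z)) + fst h * F' (fst z) * G' (snd z))"])
    show "((\<lambda>z. F (fst z) * G (snd z)) has_derivative
      (\<lambda>h. (F' (fst z) * G (snd z), F (fst z) * G' (snd z)) \<bullet> h)) (at z)" for z
      by (rule derivative_eq_intros d refl)+ (auto simp: inner_prod_def algebra_simps)
    show "((\<lambda>z. (F' (fst z) * G (snd z), F (fst z) * G' (snd z))) has_derivative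
      (\<lambda>h. (F' (fst z) * (snd h * G' (snd z)) + fst h * F'' (fst z) * G (snd z),
            F (fst z) * (snd h * G'' (snd z)) + fst h * F' (fst z) * G' (snd z)))) (at z)" for z
      by (rule derivative_eq_intros d refl)+
    show "continuous_on UNIV (\<lambda>z. (F' (fst z) * (snd (1, 0) * G' (snd z)) + fst (1, 0) * F'' (fst z) * G (snd z),
        F (fst z) * (snd (1, 0) * G'' (snd z)) + fst (1, 0) * F' (fst z) * G' (snd z)))"
      "continuous_on UNIV (\<lambda>z. (F' (fst z) * (snd (0, 1) * G' (snd z)) + fst (0, 1) * F'' (fst z) * G (snd z),
        F (fst z) * (snd (0, 1) * G'' (snd z)) + fst (0, 1) * F' (fst z) * G' (snd z)))"
      by (intro continuous_intros c subset_UNIV)+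
  qed auto
qed

section \<open>Restriction to lines, symmetry of the Hessian and the second-order condition at a
  minimum\<close>

lemma has_real_derivative_along_line:
  fixes F :: "'a::real_normed_vector \<Rightarrow> real"
  assumes "(F has_derivative D) (at (p + t *\<^sub>R v))"
  shows "((\<lambda>t. F (p + t *\<^sub>R v)) has_real_derivative D v) (at t)"
proof -
  have "((\<lambda>t. p + t *\<^sub>R v) has_derivative (\<lambda>h. h *\<^sub>R v)) (at t)"
    by (auto intro!: derivative_eq_intros)
  from has_derivative_compose[OF this assms]
  have "((\<lambda>t. F (p + t *\<^sub>R v)) has_derivative (\<lambda>h. D (h *\<^sub>R v))) (at t)" .
  moreover have "(\<lambda>h. D (h *\<^sub>R v)) = (*) (D v)"
    using linear_scale[OF has_derivative_linear[OF assms]] by (auto simp: mult.commute)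
  ultimately show ?thesis
    by (simp add: has_field_derivative_def)
qed

text \<open>The mean value theorem is applied twice: in direction \<open>v\<close> to the increment
  of \<psi> across \<open>s *\<^sub>R w\<close>, then in direction \<open>w\<close> to the
  \<open>v\<close>-component of the gradient.\<close>

lemma second_difference_mvt:
  fixes \<psi> :: "'a::real_inner \<Rightarrow> real"
  assumes "0 < s" and sub: "\<And>\<sigma> \<tau>. 0 \<le> \<sigma> \<Longrightarrow> \<sigma> \<le> s \<Longrightarrow> 0 \<le> \<tau> \<Longrightarrow> \<tau> \<le> s \<Longrightarrow> p + \<sigma> *\<^sub>R v + \<tau> *\<^sub>R w \<in> U"
    and g: "\<And>z. z \<in> U \<Longrightarrow> (\<psi> has_derivative (\<lambda>h. g z \<bullet> h)) (at z)"
    and H: "\<And>z. z \<in> U \<Longrightarrow> (g has_derivative H z) (at z)"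
  shows "\<exists>\<sigma> \<tau>. 0 < \<sigma> \<and> \<sigma> < s \<and> 0 < \<tau> \<and> \<tau> < s \<and>
    \<psi> (p + s *\<^sub>R v + s *\<^sub>R w) - \<psi> (p + s *\<^sub>R v) - \<psi> (p + s *\<^sub>R w) + \<psi> p
      = s\<^sup>2 * (H (p + \<sigma> *\<^sub>R v + \<tau> *\<^sub>R w) w \<bullet> v)"
proof -
  let ?k = "\<lambda>\<sigma>. \<psi> ((p + s *\<^sub>R w) + \<sigma> *\<^sub>R v) - \<psi> (p + \<sigma> *\<^sub>R v)"
  let ?k' = "\<lambda>\<sigma>. g ((p + s *\<^sub>R w) + \<sigma> *\<^sub>R v) \<bullet> v - g (p + \<sigma> *\<^sub>R v) \<bullet> v"
  have "(?k has_real_derivative ?k' \<sigma>) (at \<sigma>)" if "0 \<le> \<sigma>" "\<sigma> \<le> s" for \<sigma>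
  proof -
    have "p + s *\<^sub>R w + \<sigma> *\<^sub>R v \<in> U" "p + \<sigma> *\<^sub>R v \<in> U"
      using sub[of \<sigma> s] sub[of \<sigma> 0] that \<open>0 < s\<close> by (auto simp: algebra_simps)
    then show ?thesis
      by (intro derivative_intros has_real_derivative_along_line g)
  qed
  from MVT2[OF \<open>0 < s\<close>, of ?k ?k', OF this] obtain \<sigma> where \<sigma>: "0 < \<sigma>" "\<sigma> < s" "?k s - ?k 0 = s * ?k' \<sigma>"
    by auto
  let ?l = "\<lambda>\<tau>. g (p + \<sigma> *\<^sub>R v + \<tau> *\<^sub>R w) \<bullet> v"
  let ?l' = "\<lambda>\<tau>. H (p + \<sigma> *\<^sub>R v + \<tau> *\<^sub>R w) w \<bullet> v"
  have "(?l has_real_derivative ?l' \<tau>) (at \<tau>)" if "0 \<le> \<tau>" "\<tau> \<le> s" for \<tau>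
  proof -
    have "((\<lambda>z. g z \<bullet> v) has_derivative (\<lambda>h. H (p + \<sigma> *\<^sub>R v + \<tau> *\<^sub>R w) h \<bullet> v)) (at (p + \<sigma> *\<^sub>R v + \<tau> *\<^sub>R w))"
      using H[OF sub[of \<sigma> \<tau>]] that \<sigma> by (intro derivative_intros) auto
    from has_real_derivative_along_line[OF this] show ?thesis .
  qed
  from MVT2[OF \<open>0 < s\<close>, of ?l ?l', OF this] obtain \<tau> where \<tau>: "0 < \<tau>" "\<tau> < s" "?l s - ?l 0 = s * ?l' \<tau>"
    by auto
  have "?k' \<sigma> = ?l s - ?l 0"
    by (simp add: algebra_simps)
  then have "?k s - ?k 0 = s\<^sup>2 * ?l' \<tau>"
    using \<sigma> \<tau> by (simp add: power2_eq_square)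
  then show ?thesis
    using \<sigma> \<tau> by (intro exI[of _ \<sigma>] exI[of _ \<tau>]) (simp add: algebra_simps)
qed

lemma second_difference_near:
  fixes \<psi> :: "'a::real_inner \<Rightarrow> real"
  assumes "open U" "p \<in> U" "0 < e"
    and g: "\<And>z. z \<in> U \<Longrightarrow> (\<psi> has_derivative (\<lambda>h. g z \<bullet> h)) (at z)"
    and H: "\<And>z. z \<in> U \<Longrightarrow> (g has_derivative H z) (at z)"
  shows "\<exists>r>0. \<forall>s. 0 < s \<and> s < r \<longrightarrow> (\<exists>z. dist z p < e \<and>
    \<psi> (p + s *\<^sub>R v + s *\<^sub>R w) - \<psi> (p + s *\<^sub>R v) - \<psi> (p + s *\<^sub>R w) + \<psi> p = s\<^sup>2 * (H z w \<bullet> v))"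
proof -
  have "open (U \<inter> ball p e)" "p \<in> U \<inter> ball p e"
    using assms by auto
  then obtain d where d: "0 < d" "ball p d \<subseteq> U \<inter> ball p e"
    using open_contains_ball by metis
  \<comment> \<open>Every point of the parallelogram lies within \<open>s * N\<close> of
    \<open>p\<close>; the summand 1 keeps \<open>N\<close> positive when both directions
    vanish.\<close>
  define N where "N = norm v + norm w + 1"
  have N: "0 < N" by (simp add: N_def add_nonneg_pos)
  have "\<exists>z. dist z p < e \<and>
    \<psi> (p + s *\<^sub>R v + s *\<^sub>R w) - \<psi> (p + s *\<^sub>R v) - \<psi> (p + s *\<^sub>R w) + \<psi> p = s\<^sup>2 * (H z w \<bullet> v)"
    if s: "0 < s" "s < d / N" for s
  proof -
    have sub: "p + \<sigma> *\<^sub>R v + \<tau> *\<^sub>R w \<in> U \<inter> ball p e"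
      if "0 \<le> \<sigma>" "\<sigma> \<le> s" "0 \<le> \<tau>" "\<tau> \<le> s" for \<sigma> \<tau>
    proof -
      have "dist (p + \<sigma> *\<^sub>R v + \<tau> *\<^sub>R w) p = norm (\<sigma> *\<^sub>R v + \<tau> *\<^sub>R w)"
        by (simp add: dist_norm algebra_simps)
      also have "\<dots> \<le> \<sigma> * norm v + \<tau> * norm w"
        using norm_triangle_ineq[of "\<sigma> *\<^sub>R v" "\<tau> *\<^sub>R w"] that by simp
      also have "\<dots> \<le> s * norm v + s * norm w"
        using that by (intro add_mono mult_right_mono) auto
      also have "\<dots> \<le> s * N"
        using s by (simp add: N_def algebra_simps)
      also have "\<dots> < d"
        using s N by (simp add: pos_less_divide_eq)
      finally have "p + \<sigma> *\<^sub>R v + \<tau> *\<^sub>R w \<in> ball p d"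
        by (simp add: dist_commute)
      then show ?thesis using d(2) by blast
    qed
    have subU: "p + \<sigma> *\<^sub>R v + \<tau> *\<^sub>R w \<in> U"
      if "0 \<le> \<sigma>" "\<sigma> \<le> s" "0 \<le> \<tau>" "\<tau> \<le> s" for \<sigma> \<tau>
      using sub[OF that] by blast
    obtain \<sigma> \<tau> where st: "0 < \<sigma>" "\<sigma> < s" "0 < \<tau>" "\<tau> < s" and
      eq: "\<psi> (p + s *\<^sub>R v + s *\<^sub>R w) - \<psi> (p + s *\<^sub>R v) - \<psi> (p + s *\<^sub>R w) + \<psi> p
        = s\<^sup>2 * (H (p + \<sigma> *\<^sub>R v + \<tau> *\<^sub>R w) w \<bullet> v)"
      using second_difference_mvt[where U = U and p = p and v = v and w = w and \<psi> = \<psi> and g = g and H = H,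
          OF s(1) subU g H] by blast
    have "dist (p + \<sigma> *\<^sub>R v + \<tau> *\<^sub>R w) p < e"
      using sub[of \<sigma> \<tau>] st by (simp add: dist_commute)
    then show ?thesis using eq by blast
  qed
  moreover have "0 < d / N" using d N by simp
  ultimately show ?thesis by blast
qed

text \<open>The second difference is symmetric in \<open>v\<close> and \<open>w\<close>, so the two
  mixed derivatives agree at points arbitrarily close to \<open>p\<close>, and continuity gives
  equality at \<open>p\<close>. This is needed because \<open>C2_hess_at\<close> records only one
  off-diagonal entry.\<close>

lemma second_derivative_symmetric:
  fixes \<psi> :: "'a::real_inner \<Rightarrow> real"
  assumes "open U" "p \<in> U"
    and g: "\<And>z. z \<in> U \<Longrightarrow> (\<psi> has_derivative (\<lambda>h. g z \<bullet> h)) (at z)"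
    and H: "\<And>z. z \<in> U \<Longrightarrow> (g has_derivative H z) (at z)"
    and cont: "continuous_on U (\<lambda>z. H z v)" "continuous_on U (\<lambda>z. H z w)"
  shows "H p v \<bullet> w = H p w \<bullet> v"
proof -
  have "\<exists>z z'. dist z p < e \<and> dist z' p < e \<and> H z v \<bullet> w = H z' w \<bullet> v" if e0: "0 < e" for e
  proof -
    obtain r where r: "0 < r" "\<And>s. 0 < s \<Longrightarrow> s < r \<Longrightarrow> \<exists>z. dist z p < e \<and>
      \<psi> (p + s *\<^sub>R v + s *\<^sub>R w) - \<psi> (p + s *\<^sub>R v) - \<psi> (p + s *\<^sub>R w) + \<psi> p = s\<^sup>2 * (H z w \<bullet> v)"
      using second_difference_near[OF assms(1,2) e0 g H, of v w] by metis
    obtain r' where r': "0 < r'" "\<And>s. 0 < s \<Longrightarrow> s < r' \<Longrightarrow> \<exists>z. dist z p < e \<and>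
      \<psi> (p + s *\<^sub>R w + s *\<^sub>R v) - \<psi> (p + s *\<^sub>R w) - \<psi> (p + s *\<^sub>R v) + \<psi> p = s\<^sup>2 * (H z v \<bullet> w)"
      using second_difference_near[OF assms(1,2) e0 g H, of w v] by metis
    define s where "s = min r r' / 2"
    have s: "0 < s" "s < r" "s < r'" using r(1) r'(1) by (auto simp: s_def)
    obtain z where z: "dist z p < e"
      "\<psi> (p + s *\<^sub>R v + s *\<^sub>R w) - \<psi> (p + s *\<^sub>R v) - \<psi> (p + s *\<^sub>R w) + \<psi> p = s\<^sup>2 * (H z w \<bullet> v)"
      using r(2)[OF s(1,2)] by blast
    obtain z' where z': "dist z' p < e"
      "\<psi> (p + s *\<^sub>R w + s *\<^sub>R v) - \<psi> (p + s *\<^sub>R w) - \<psi> (p + s *\<^sub>R v) + \<psi> p = s\<^sup>2 * (H z' v \<bullet> w)"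
      using r'(2)[OF s(1,3)] by blast
    have "p + s *\<^sub>R w + s *\<^sub>R v = p + s *\<^sub>R v + s *\<^sub>R w"
      by (simp add: algebra_simps)
    then have "s\<^sup>2 * (H z w \<bullet> v) = s\<^sup>2 * (H z' v \<bullet> w)"
      using z(2) z'(2) by (metis add.commute diff_diff_eq)
    then have "H z' v \<bullet> w = H z w \<bullet> v" using s(1) by simp
    then show ?thesis using z(1) z'(1) by blast
  qed
  then have "\<forall>n. \<exists>z z'. dist z p < 1 / real (Suc n) \<and> dist z' p < 1 / real (Suc n) \<and> H z v \<bullet> w = H z' w \<bullet> v"
    by simp
  then obtain P Q where PQ: "\<And>n. dist (P n) p < 1 / real (Suc n)" "\<And>n. dist (Q n) p < 1 / real (Suc n)"
    and eq: "\<And>n. H (P n) v \<bullet> w = H (Q n) w \<bullet> v"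
    by metis
  have "P \<longlonglongrightarrow> p" "Q \<longlonglongrightarrow> p"
    using LIMSEQ_norm_0[of "\<lambda>n. P n - p"] LIMSEQ_norm_0[of "\<lambda>n. Q n - p"] PQ
    by (auto simp: dist_norm intro: LIM_zero_cancel)
  moreover have "isCont (\<lambda>z. H z v) p" "isCont (\<lambda>z. H z w) p"
    using cont assms(1,2) by (auto simp: continuous_on_eq_continuous_at)
  ultimately have "(\<lambda>n. H (P n) v \<bullet> w) \<longlonglongrightarrow> H p v \<bullet> w" "(\<lambda>n. H (Q n) w \<bullet> v) \<longlonglongrightarrow> H p w \<bullet> v"
    by (auto intro!: tendsto_inner tendsto_const intro: isCont_tendsto_compose)
  then show ?thesis
    using eq LIMSEQ_unique by auto
qed

text \<open>The first derivative vanishes at 0. Were \<open>d\<close> negative, it would be negative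
  just to the right of 0, and the mean value theorem would push \<open>k\<close> below its
  minimum.\<close>

lemma DERIV_second_nonneg_at_min:
  fixes k :: "real \<Rightarrow> real"
  assumes k: "\<forall>\<^sub>F t in nhds 0. (k has_real_derivative k' t) (at t)"
    and k': "(k' has_real_derivative d) (at 0)"
    and min: "\<forall>\<^sub>F t in nhds 0. k 0 \<le> k t"
  shows "0 \<le> d"
proof (rule ccontr)
  assume "\<not> 0 \<le> d"
  then have "d < 0" by simp
  from k min have "\<forall>\<^sub>F t in nhds 0. (k has_real_derivative k' t) (at t) \<and> k 0 \<le> k t"
    by (rule eventually_conj)
  then obtain e where e: "0 < e" "\<And>t. \<bar>t\<bar> < e \<Longrightarrow> (k has_real_derivative k' t) (at t)"
    "\<And>t. \<bar>t\<bar> < e \<Longrightarrow> k 0 \<le> k t"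
    unfolding eventually_nhds_metric by (auto simp: dist_real_def)
  have "k' 0 = 0"
    using e by (intro DERIV_local_min[of k "k' 0" 0 e]) auto
  obtain e' where e': "0 < e'" "\<And>h. 0 < h \<Longrightarrow> h < e' \<Longrightarrow> k' (0 + h) < k' 0"
    using DERIV_neg_dec_right[OF k' \<open>d < 0\<close>] by auto
  define r where "r = min e e' / 2"
  have r: "0 < r" "r < e" "r < e'" using e e' by (auto simp: r_def)
  obtain z where "0 < z" "z < r" "k r - k 0 = (r - 0) * k' z"
    using MVT2[OF r(1), of k k'] e(2) r by auto
  moreover have "k' z < 0"
    using e'(2)[of z] calculation r \<open>k' 0 = 0\<close> by auto
  ultimately have "k r < k 0"
    using r mult_pos_neg[of r "k' z"] by simp
  then show False
    using e(3)[of r] r by simp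
qed

text \<open>Restriction to the line through \<open>z0\<close> with direction \<open>(h, k)\<close>
  reduces this to one variable; symmetry of the second derivative merges the mixed terms.\<close>

lemma C2_hess_at_local_min:
  assumes "C2_hess_at \<psi> z0 a b c" and min: "\<forall>\<^sub>F z in at z0. \<psi> z0 \<le> \<psi> z"
  shows "a * h\<^sup>2 + 2 * b * h * k + c * k\<^sup>2 \<ge> 0"
proof -
  from assms(1) obtain U g H where 1: "open U" "z0 \<in> U"
    and g: "\<forall>z\<in>U. (\<psi> has_derivative (\<lambda>h. g z \<bullet> h)) (at z)"
    and H: "\<forall>z\<in>U. (g has_derivative H z) (at z)"
    and cont: "continuous_on U (\<lambda>z. H z (1, 0))" "continuous_on U (\<lambda>z. H z (0, 1))"
    and abc: "a = fst (H z0 (1, 0))" "b = snd (H z0 (1, 0))" "c = snd (H z0 (0, 1))"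
    by (rule C2_hess_atE)
  note g = bspec[OF g] and H = bspec[OF H]
  have sym: "fst (H z0 (0, 1)) = b"
    using second_derivative_symmetric[OF 1 g H cont] abc by (simp add: inner_prod_def)
  let ?v = "(h, k)"
  have lim: "filterlim (\<lambda>t. z0 + t *\<^sub>R ?v) (nhds z0) (nhds 0)"
    by (rule tendsto_eq_intros filterlim_ident refl | simp add: zero_prod_def)+
  have "\<forall>\<^sub>F z in nhds z0. z \<in> U" using 1 by (simp add: eventually_nhds_in_open)
  then have evU: "\<forall>\<^sub>F t in nhds 0. z0 + t *\<^sub>R ?v \<in> U"
    using lim by (rule eventually_compose_filterlim)
  have "\<forall>\<^sub>F z in nhds z0. \<psi> z0 \<le> \<psi> z" using min by (auto simp: eventually_nhds_conv_at)
  then have ev: "\<forall>\<^sub>F t in nhds 0. \<psi> z0 \<le> \<psi> (z0 + t *\<^sub>R ?v)"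
    using lim by (rule eventually_compose_filterlim)
  have "0 \<le> H z0 ?v \<bullet> ?v"
  proof (rule DERIV_second_nonneg_at_min)
    show "\<forall>\<^sub>F t in nhds 0. ((\<lambda>t. \<psi> (z0 + t *\<^sub>R ?v)) has_real_derivative g (z0 + t *\<^sub>R ?v) \<bullet> ?v) (at t)"
      using evU by eventually_elim (intro has_real_derivative_along_line g)
    have "((\<lambda>z. g z \<bullet> ?v) has_derivative (\<lambda>h. H z0 h \<bullet> ?v)) (at (z0 + 0 *\<^sub>R ?v))"
      using H[OF 1(2)] by (auto intro!: derivative_intros simp: zero_prod_def[symmetric])
    from has_real_derivative_along_line[OF this]
    show "((\<lambda>t. g (z0 + t *\<^sub>R ?v) \<bullet> ?v) has_real_derivative H z0 ?v \<bullet> ?v) (at 0)" .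
    show "\<forall>\<^sub>F t in nhds 0. \<psi> (z0 + 0 *\<^sub>R ?v) \<le> \<psi> (z0 + t *\<^sub>R ?v)"
      using ev unfolding scaleR_zero_left add_0_right .
  qed
  moreover have "H z0 ?v = h *\<^sub>R H z0 (1, 0) + k *\<^sub>R H z0 (0, 1)"
  proof -
    have lin: "linear (H z0)" using H[OF 1(2)] by (rule has_derivative_linear)
    have "?v = h *\<^sub>R (1, 0) + k *\<^sub>R (0, 1)" by simp
    then have "H z0 ?v = H z0 (h *\<^sub>R (1, 0) + k *\<^sub>R (0, 1))" by (rule arg_cong)
    then show ?thesis unfolding linear_add[OF lin] linear_scale[OF lin] .
  qed
  ultimately show ?thesis
    using sym abc by (simp add: inner_prod_def algebra_simps power2_eq_square)
qed

lemma C2_hess_at_separated: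
  fixes F G :: "real \<Rightarrow> real"
  assumes F: "\<And>x. (F has_real_derivative F' x) (at x)" "\<And>x. (F' has_real_derivative F'' x) (at x)"
      "continuous_on UNIV F''"
    and G: "\<And>x. (G has_real_derivative G' x) (at x)" "\<And>x. (G' has_real_derivative G'' x) (at x)"
      "continuous_on UNIV G''"
  shows "C2_hess_at (\<lambda>z. k * F (fst z) + G (snd z)) z (k * F'' (fst z)) 0 (G'' (snd z))"
proof -
  have one: "((\<lambda>_. 1) has_real_derivative 0) (at x)" "((\<lambda>_. 0) has_real_derivative 0) (at x)" for x :: real
    by auto
  have "C2_hess_at (\<lambda>z. F (fst z) * 1) z (F'' (fst z)) 0 0"
    using C2_hess_at_prod[OF F one, of "fst z" "snd z"] by simp
  moreover have "C2_hess_at (\<lambda>z. 1 * G (snd z)) z 0 0 (G'' (snd z))"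
    using C2_hess_at_prod[OF one _ G, of "fst z" "snd z"] by simp
  ultimately show ?thesis
    using C2_hess_at_add[OF C2_hess_at_cmult[of "\<lambda>z. F (fst z) * 1" z "F'' (fst z)" 0 0 k]] by fastforce
qed

section \<open>Viscosity supersolutions and the strong maximum principle\<close>

lemma C2_hess_at_const: "C2_hess_at (\<lambda>z. k) z 0 0 0"
  by (cases z) (use C2_hess_at_prod[of "\<lambda>_. k" "\<lambda>_. 0" "\<lambda>_. 0" "\<lambda>_. 1" "\<lambda>_. 0" "\<lambda>_. 0"] in simp)

text \<open>At a touching point \<open>v - \<psi>\<close> has a local minimum, so the Hessians are
  ordered and ellipticity applies. Keeping \<phi> apart from \<open>v\<close> allows an explicit
  formula that agrees with the smooth function only on \<Omega>.\<close>

lemma classical_imp_visc_super: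
  assumes lam: "0 < lam" "lam \<le> Lam" and "open \<Omega>"
    and cl: "\<And>z. z \<in> \<Omega> \<Longrightarrow> \<exists>a b c. C2_hess_at v z a b c \<and> pucci_plus lam Lam a b c + \<mu> * v z \<le> 0"
    and eq: "\<And>z. z \<in> \<Omega> \<Longrightarrow> \<phi> z = v z"
  shows "visc_super lam Lam \<mu> \<Omega> \<phi>"
  unfolding visc_super_def
proof (intro ballI allI impI, elim conjE)
  fix z0 \<psi> a b c
  assume z0: "z0 \<in> \<Omega>" and \<psi>: "C2_hess_at \<psi> z0 a b c" "\<psi> z0 = \<phi> z0"
    and ev: "\<forall>\<^sub>F z in at z0. \<psi> z \<le> \<phi> z"
  obtain a' b' c' where v: "C2_hess_at v z0 a' b' c'" "pucci_plus lam Lam a' b' c' + \<mu> * v z0 \<le> 0"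
    using cl[OF z0] by blast
  have "\<forall>\<^sub>F z in at z0. z \<in> \<Omega>"
    using \<open>open \<Omega>\<close> z0 by (rule eventually_at_in_open')
  with ev have "\<forall>\<^sub>F z in at z0. v z0 - \<psi> z0 \<le> v z - \<psi> z"
    by eventually_elim (use eq z0 \<psi>(2) in simp)
  from C2_hess_at_local_min[OF C2_hess_at_diff[OF v(1) \<psi>(1)] this]
  have "pucci_plus lam Lam a b c \<le> pucci_plus lam Lam a' b' c'"
    by (intro pucci_plus_mono[OF lam])
  then show "pucci_plus lam Lam a b c + \<mu> * \<phi> z0 \<le> 0"
    using v(2) eq[OF z0] by simp
qed

lemma classical_imp_visc_sub:
  assumes lam: "0 < lam" "lam \<le> Lam" and "open \<Omega>"
    and cl: "\<And>z. z \<in> \<Omega> \<Longrightarrow> \<exists>a b c. C2_hess_at v z a b c \<and> 0 \<le> pucci_plus lam Lam a b c + \<mu> * v z"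
    and eq: "\<And>z. z \<in> \<Omega> \<Longrightarrow> \<phi> z = v z"
  shows "visc_sub lam Lam \<mu> \<Omega> \<phi>"
  unfolding visc_sub_def
proof (intro ballI allI impI, elim conjE)
  fix z0 \<psi> a b c
  assume z0: "z0 \<in> \<Omega>" and \<psi>: "C2_hess_at \<psi> z0 a b c" "\<psi> z0 = \<phi> z0"
    and ev: "\<forall>\<^sub>F z in at z0. \<phi> z \<le> \<psi> z"
  obtain a' b' c' where v: "C2_hess_at v z0 a' b' c'" "0 \<le> pucci_plus lam Lam a' b' c' + \<mu> * v z0"
    using cl[OF z0] by blast
  have "\<forall>\<^sub>F z in at z0. z \<in> \<Omega>"
    using \<open>open \<Omega>\<close> z0 by (rule eventually_at_in_open')
  with ev have "\<forall>\<^sub>F z in at z0. \<psi> z0 - v z0 \<le> \<psi> z - v z"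
    by eventually_elim (use eq z0 \<psi>(2) in simp)
  from C2_hess_at_local_min[OF C2_hess_at_diff[OF \<psi>(1) v(1)] this]
  have "pucci_plus lam Lam a' b' c' \<le> pucci_plus lam Lam a b c"
    by (intro pucci_plus_mono[OF lam])
  then show "0 \<le> pucci_plus lam Lam a b c + \<mu> * \<phi> z0"
    using v(2) eq[OF z0] by simp
qed

text \<open>Contact principle: \<open>v - h\<close> serves as test function, and subadditivity moves
  the inequality onto \<open>h\<close>. A strict supersolution \<open>h\<close> is thereby excluded
  at the contact point.\<close>

lemma visc_super_touch:
  assumes "lam \<le> Lam" "visc_super lam Lam \<mu> \<Omega> \<phi>" "z0 \<in> \<Omega>"
    and v: "C2_hess_at v z0 a b c" "0 \<le> pucci_plus lam Lam a b c + \<mu> * v z0"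
    and h: "C2_hess_at h z0 a' b' c'"
    and touch: "\<phi> z0 = v z0 - h z0" "\<forall>\<^sub>F z in at z0. v z - h z \<le> \<phi> z"
  shows "0 \<le> pucci_plus lam Lam a' b' c' + \<mu> * h z0"
proof -
  have "pucci_plus lam Lam (a - a') (b - b') (c - c') + \<mu> * \<phi> z0 \<le> 0"
    using assms(2,3) C2_hess_at_diff[OF v(1) h] touch unfolding visc_super_def by metis
  moreover have "pucci_plus lam Lam a b c
      \<le> pucci_plus lam Lam (a - a') (b - b') (c - c') + pucci_plus lam Lam a' b' c'"
    using pucci_plus_add[OF assms(1), of "a - a'" a' "b - b'" b' "c - c'" c'] by simp
  ultimately show ?thesis
    using v(2) touch(1) by (simp add: algebra_simps)
qed

section \<open>Gaussian barrier and strong maximum principle\<close>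

lemma C2_hess_at_gaussian:
  fixes \<alpha> :: real and p z :: "real \<times> real"
  defines "E \<equiv> (\<lambda>z. exp (- \<alpha> * (fst z - fst p)\<^sup>2) * exp (- \<alpha> * (snd z - snd p)\<^sup>2))"
  shows "C2_hess_at E z
    (E z * (4 * \<alpha>\<^sup>2 * (fst z - fst p)\<^sup>2 - 2 * \<alpha>))
    (E z * (4 * \<alpha>\<^sup>2 * (fst z - fst p) * (snd z - snd p)))
    (E z * (4 * \<alpha>\<^sup>2 * (snd z - snd p)\<^sup>2 - 2 * \<alpha>))"
proof -
  have 1: "((\<lambda>x. exp (- \<alpha> * (x - m)\<^sup>2)) has_real_derivative
      - 2 * \<alpha> * (x - m) * exp (- \<alpha> * (x - m)\<^sup>2)) (at x)" for x m
    by (auto intro!: derivative_eq_intros)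
  have 2: "((\<lambda>x. - 2 * \<alpha> * (x - m) * exp (- \<alpha> * (x - m)\<^sup>2)) has_real_derivative
      (4 * \<alpha>\<^sup>2 * (x - m)\<^sup>2 - 2 * \<alpha>) * exp (- \<alpha> * (x - m)\<^sup>2)) (at x)" for x m
    by (auto intro!: derivative_eq_intros simp: power2_eq_square algebra_simps)
  have 3: "continuous_on UNIV (\<lambda>x. (4 * \<alpha>\<^sup>2 * (x - m)\<^sup>2 - 2 * \<alpha>) * exp (- \<alpha> * (x - m)\<^sup>2))" for m
    by (intro continuous_intros)
  show ?thesis
    using C2_hess_at_prod[OF 1[of "fst p"] 2[of "fst p"] 3[of "fst p"] 1[of "snd p"] 2[of "snd p"] 3[of "snd p"],
        of "fst z" "snd z"]
    unfolding E_def by (simp add: power2_eq_square algebra_simps)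
qed

text \<open>The matrix splits into 2\<alpha> times the identity, which contributes at most
  \<open>4 * \<alpha> * Lam\<close>, and a negative rank-one part of order \<alpha> squared, which
  dominates once \<alpha> is large relative to the distance from the centre.\<close>

lemma pucci_plus_minus_gaussian_neg:
  assumes lam: "0 < lam" "lam \<le> Lam" and "0 < t" "0 < \<alpha>" and big: "Lam < \<alpha> * lam * (p\<^sup>2 + q\<^sup>2)"
  shows "pucci_plus lam Lam (t * (2 * \<alpha> - 4 * \<alpha>\<^sup>2 * p\<^sup>2)) (t * (- (4 * \<alpha>\<^sup>2 * p * q)))
    (t * (2 * \<alpha> - 4 * \<alpha>\<^sup>2 * q\<^sup>2)) < 0"
proof -
  have "pucci_plus lam Lam (2 * \<alpha> + - (4 * \<alpha>\<^sup>2) * p\<^sup>2) (0 + - (4 * \<alpha>\<^sup>2) * p * q) (2 * \<alpha> + - (4 * \<alpha>\<^sup>2) * q\<^sup>2)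
    \<le> pucci_plus lam Lam (2 * \<alpha>) 0 (2 * \<alpha>)
      + pucci_plus lam Lam (- (4 * \<alpha>\<^sup>2) * p\<^sup>2) (- (4 * \<alpha>\<^sup>2) * p * q) (- (4 * \<alpha>\<^sup>2) * q\<^sup>2)"
    by (rule pucci_plus_add[OF lam(2)])
  also have "\<dots> = 4 * \<alpha> * (Lam - \<alpha> * lam * (p\<^sup>2 + q\<^sup>2))"
    using pucci_plus_minus_rank_one[OF lam(2), of "4 * \<alpha>\<^sup>2" p q] \<open>0 < \<alpha>\<close>
    unfolding pucci_plus_diag[OF lam(2)] by (simp add: power2_eq_square algebra_simps)
  also have "\<dots> < 0"
    using big \<open>0 < \<alpha>\<close> by (simp add: mult_pos_neg)
  finally show ?thesis
    unfolding pucci_plus_scale[OF lam(2) less_imp_le[OF \<open>0 < t\<close>]] using \<open>0 < t\<close>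
    by (simp add: mult_pos_neg)
qed

text \<open>The Gaussian barrier is centred at a point where the two functions differ and is compared
  with their difference on the annulus \<open>r/2 \<le> \<bar>z - p\<bar> \<le> 3r/2\<close>, where \<open>r\<close> is the distance of the centre \<open>p\<close> to
  the contact set. It is negative beyond radius \<open>r\<close>, so the minimum of the difference lies inside.\<close>

lemma contact_set_open:
  fixes z1 :: "real \<times> real"
  assumes lam: "0 < lam" "lam \<le> Lam" and "0 \<le> \<mu>" and "open \<Omega>"
    and \<phi>: "continuous_on \<Omega> \<phi>" "visc_super lam Lam \<mu> \<Omega> \<phi>"
    and v: "continuous_on \<Omega> v"
      "\<And>z. z \<in> \<Omega> \<Longrightarrow> \<exists>a b c. C2_hess_at v z a b c \<and> 0 \<le> pucci_plus lam Lam a b c + \<mu> * v z"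
    and le: "\<And>z. z \<in> \<Omega> \<Longrightarrow> v z \<le> \<phi> z"
    and z1: "z1 \<in> \<Omega>" "\<phi> z1 = v z1"
  shows "\<exists>\<rho>>0. \<forall>z\<in>ball z1 \<rho>. z \<in> \<Omega> \<and> \<phi> z = v z"
proof -
  obtain R where R: "0 < R" "cball z1 R \<subseteq> \<Omega>"
    using \<open>open \<Omega>\<close> z1 open_contains_cball by metis
  \<comment> \<open>Since \<open>r < \<rho>\<close>, the ball of radius \<open>3 * r / 2\<close>
    about \<open>p\<close> stays within R/3 + R/2 of \<open>z1\<close>, hence inside the ball of
    radius \<open>R\<close>.\<close>
  define \<rho> where "\<rho> = R / 3"
  have \<rho>: "0 < \<rho>" using R by (simp add: \<rho>_def)
  have "\<phi> p = v p" if p: "p \<in> ball z1 \<rho>" for p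
  proof (rule ccontr)
    assume ne: "\<phi> p \<noteq> v p"
    define Z where "Z = {z \<in> cball z1 R. \<phi> z = v z}"
    have "compact Z"
    proof -
      have "continuous_on (cball z1 R) (\<lambda>z. \<phi> z - v z)"
        using \<phi>(1) v(1) R(2) by (intro continuous_intros) (auto elim: continuous_on_subset)
      then have "closed (cball z1 R \<inter> (\<lambda>z. \<phi> z - v z) -` {0})"
        by (intro continuous_closed_preimage) auto
      moreover have "cball z1 R \<inter> (\<lambda>z. \<phi> z - v z) -` {0} = Z"
        by (auto simp: Z_def)
      ultimately have "closed Z" by simp
      moreover have "bounded Z" unfolding Z_def by (rule bounded_subset[OF bounded_cball]) auto
      ultimately show ?thesis by (simp add: compact_eq_bounded_closed)
    qed
    moreover have "z1 \<in> Z" using z1 R by (simp add: Z_def)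
    ultimately obtain zs where zs: "zs \<in> Z" "\<And>z. z \<in> Z \<Longrightarrow> dist p zs \<le> dist p z"
      using distance_attains_inf[of Z p] compact_imp_closed by blast
    define r where "r = dist p zs"
    have r: "0 < r" "r \<le> dist p z1" "r < \<rho>"
    proof -
      have "p \<noteq> zs" using ne zs(1) by (auto simp: Z_def)
      then show "0 < r" by (simp add: r_def)
      show "r \<le> dist p z1" using zs(2)[OF \<open>z1 \<in> Z\<close>] by (simp add: r_def)
      then show "r < \<rho>" using p by (simp add: dist_commute)
    qed
    define K where "K = cball p (3 * r / 2) - ball p (r / 2)"
    have K: "compact K" "K \<subseteq> cball z1 R"
    proof -
      show "compact K" unfolding K_def by (intro compact_diff) auto
      show "K \<subseteq> cball z1 R"
      proof
        fix z assume "z \<in> K"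
        then have "dist p z \<le> 3 * r / 2" by (simp add: K_def)
        then have "dist z1 z \<le> R"
          using dist_triangle[of z1 z p] p r by (simp add: \<rho>_def dist_commute)
        then show "z \<in> cball z1 R" by simp
      qed
    qed
    have K\<Omega>: "K \<subseteq> \<Omega>" using K R by blast
    \<comment> \<open>This gives \<open>\<alpha> * lam * (r / 2)\<^sup>2 = 2 * Lam\<close>, so the
      barrier inequality holds throughout the annulus.\<close>
    define \<alpha> where "\<alpha> = 8 * Lam / (lam * r\<^sup>2)"
    have \<alpha>: "0 < \<alpha>" using lam r by (simp add: \<alpha>_def)
    define E where "E = (\<lambda>z. exp (- \<alpha> * (fst z - fst p)\<^sup>2) * exp (- \<alpha> * (snd z - snd p)\<^sup>2))"
    have dist2: "(dist p z)\<^sup>2 = (fst z - fst p)\<^sup>2 + (snd z - snd p)\<^sup>2" for z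
      by (cases p; cases z) (simp add: dist_Pair_Pair dist_real_def power2_commute)
    have E: "E z = exp (- \<alpha> * (dist p z)\<^sup>2)" for z
      unfolding E_def dist2 by (simp add: exp_add[symmetric] algebra_simps)
    define \<kappa> where "\<kappa> = exp (- \<alpha> * r\<^sup>2)"
    define W where "W z = \<phi> z - v z" for z
    have W0: "0 \<le> W z" if "z \<in> \<Omega>" for z using le[OF that] by (simp add: W_def)
    have Wcont: "continuous_on K W"
      unfolding W_def using \<phi>(1) v(1) K\<Omega> by (intro continuous_intros) (auto elim: continuous_on_subset)
    have Wpos: "0 < W z" if "z \<in> cball z1 R" "dist p z < r" for z
      using zs(2)[of z] that W0[of z] R(2) by (force simp: Z_def W_def r_def)
    have "compact (sphere p (r / 2))" "sphere p (r / 2) \<noteq> {}" "sphere p (r / 2) \<subseteq> K"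
      using r by (auto simp: K_def)
    then obtain y where y: "y \<in> sphere p (r / 2)" "\<And>z. z \<in> sphere p (r / 2) \<Longrightarrow> W y \<le> W z"
      using continuous_attains_inf[OF _ _ continuous_on_subset[OF Wcont], of "sphere p (r / 2)"] by blast
    have Wy: "0 < W y"
    proof (rule Wpos)
      show "y \<in> cball z1 R" using y(1) \<open>sphere p (r / 2) \<subseteq> K\<close> K(2) by blast
      show "dist p y < r" using y(1) r by simp
    qed
    \<comment> \<open>As \<open>E - \<kappa> < 1\<close>, half the minimum of \<open>W\<close> on
      the inner circle makes \<open>?g\<close> positive there, so its minimum is not attained on
      that circle.\<close>
    define \<epsilon> where "\<epsilon> = W y / 2"
    have \<epsilon>: "0 < \<epsilon>" using Wy by (simp add: \<epsilon>_def)
    let ?g = "\<lambda>z. W z - \<epsilon> * (E z - \<kappa>)"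
    have zsK: "zs \<in> K" using r by (simp add: K_def r_def[symmetric])
    have gzs: "?g zs = 0"
      using zs(1) by (simp add: Z_def W_def E \<kappa>_def r_def[symmetric])
    have "continuous_on K ?g"
      unfolding E_def by (intro continuous_intros Wcont)
    then obtain z0 where z0: "z0 \<in> K" "\<And>z. z \<in> K \<Longrightarrow> ?g z0 \<le> ?g z"
      using continuous_attains_inf[OF K(1)] zsK by blast
    have g0: "?g z0 \<le> 0" using z0(2)[OF zsK] gzs by simp
    have "z0 \<in> \<Omega>" using z0 K\<Omega> by blast
    have far: "dist p z0 \<le> r"
    proof (rule ccontr)
      assume "\<not> dist p z0 \<le> r"
      then have "r\<^sup>2 < (dist p z0)\<^sup>2" using r by (intro power_strict_mono) auto
      then have "E z0 < \<kappa>" using \<alpha> by (simp add: E \<kappa>_def)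
      then have "\<epsilon> * (E z0 - \<kappa>) < 0" using \<epsilon> by (simp add: mult_pos_neg)
      then show False using g0 W0[OF \<open>z0 \<in> \<Omega>\<close>] by simp
    qed
    have near: "r / 2 < dist p z0"
    proof (rule ccontr)
      assume "\<not> r / 2 < dist p z0"
      then have "z0 \<in> sphere p (r / 2)" using z0(1) by (simp add: K_def)
      then have "W y \<le> W z0" by (rule y(2))
      moreover have "\<epsilon> * (E z0 - \<kappa>) < \<epsilon> * 1"
      proof (rule mult_strict_left_mono)
        have "E z0 \<le> 1" using \<alpha> by (simp add: E)
        moreover have "0 < \<kappa>" by (simp add: \<kappa>_def)
        ultimately show "E z0 - \<kappa> < 1" by linarith
      qed (rule \<epsilon>)
      moreover have "\<epsilon> < W y" using Wy by (simp add: \<epsilon>_def)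
      ultimately show False using g0 by linarith
    qed
    have ev: "\<forall>\<^sub>F z in at z0. ?g z0 \<le> ?g z"
    proof -
      have "open (ball p (3 * r / 2) - cball p (r / 2))" by auto
      moreover have "z0 \<in> ball p (3 * r / 2) - cball p (r / 2)" using far near r by auto
      ultimately have "\<forall>\<^sub>F z in at z0. z \<in> ball p (3 * r / 2) - cball p (r / 2)"
        by (rule eventually_at_in_open')
      then show ?thesis
      proof eventually_elim
        case (elim z)
        then show ?case by (intro z0(2)) (auto simp: K_def)
      qed
    qed
    obtain a b c where vz: "C2_hess_at v z0 a b c" "0 \<le> pucci_plus lam Lam a b c + \<mu> * v z0"
      using v(2)[OF \<open>z0 \<in> \<Omega>\<close>] by blast
    \<comment> \<open>The additive constant makes \<open>v - h\<close> meet \<phi> at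
      \<open>z0\<close>; minimality of \<open>?g\<close> at \<open>z0\<close> makes it stay below
      nearby. Moreover \<open>h z0 = - W z0 \<le> 0\<close>, so the zero-order term has the right
      sign for \<open>0 \<le> \<mu>\<close>.\<close>
    define h where "h z = (\<epsilon> * E z0 - W z0) + (- \<epsilon>) * E z" for z
    let ?x = "fst z0 - fst p" and ?y = "snd z0 - snd p"
    have "C2_hess_at h z0 (0 + (- \<epsilon>) * (E z0 * (4 * \<alpha>\<^sup>2 * ?x\<^sup>2 - 2 * \<alpha>)))
        (0 + (- \<epsilon>) * (E z0 * (4 * \<alpha>\<^sup>2 * ?x * ?y))) (0 + (- \<epsilon>) * (E z0 * (4 * \<alpha>\<^sup>2 * ?y\<^sup>2 - 2 * \<alpha>)))"
      unfolding h_def E_def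
      by (rule C2_hess_at_add[OF C2_hess_at_const C2_hess_at_cmult[OF C2_hess_at_gaussian]])
    then have hC2: "C2_hess_at h z0 (\<epsilon> * E z0 * (2 * \<alpha> - 4 * \<alpha>\<^sup>2 * ?x\<^sup>2))
        (\<epsilon> * E z0 * (- (4 * \<alpha>\<^sup>2 * ?x * ?y))) (\<epsilon> * E z0 * (2 * \<alpha> - 4 * \<alpha>\<^sup>2 * ?y\<^sup>2))"
      by (simp add: algebra_simps)
    have hz0: "h z0 = - W z0" by (simp add: h_def)
    have "0 \<le> pucci_plus lam Lam (\<epsilon> * E z0 * (2 * \<alpha> - 4 * \<alpha>\<^sup>2 * ?x\<^sup>2))
        (\<epsilon> * E z0 * (- (4 * \<alpha>\<^sup>2 * ?x * ?y))) (\<epsilon> * E z0 * (2 * \<alpha> - 4 * \<alpha>\<^sup>2 * ?y\<^sup>2)) + \<mu> * h z0"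
    proof (rule visc_super_touch[OF lam(2) \<phi>(2) \<open>z0 \<in> \<Omega>\<close> vz hC2])
      show "\<phi> z0 = v z0 - h z0" by (simp add: hz0 W_def)
      show "\<forall>\<^sub>F z in at z0. v z - h z \<le> \<phi> z"
        using ev by eventually_elim (simp add: h_def W_def algebra_simps)
    qed
    moreover have "pucci_plus lam Lam (\<epsilon> * E z0 * (2 * \<alpha> - 4 * \<alpha>\<^sup>2 * ?x\<^sup>2))
        (\<epsilon> * E z0 * (- (4 * \<alpha>\<^sup>2 * ?x * ?y))) (\<epsilon> * E z0 * (2 * \<alpha> - 4 * \<alpha>\<^sup>2 * ?y\<^sup>2)) < 0"
    proof (rule pucci_plus_minus_gaussian_neg[OF lam _ \<alpha>])
      show "0 < \<epsilon> * E z0" using \<epsilon> by (simp add: E)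
      have "(r / 2)\<^sup>2 < (dist p z0)\<^sup>2" using near r by (intro power_strict_mono) auto
      then have "\<alpha> * lam * (r / 2)\<^sup>2 < \<alpha> * lam * (dist p z0)\<^sup>2"
        using \<alpha> lam by simp
      moreover have "\<alpha> * lam * (r / 2)\<^sup>2 = 2 * Lam"
        using lam r by (simp add: \<alpha>_def power2_eq_square field_simps)
      ultimately show "Lam < \<alpha> * lam * (?x\<^sup>2 + ?y\<^sup>2)"
        using lam dist2[of z0] by simp
    qed
    moreover have "\<mu> * h z0 \<le> 0"
      using \<open>0 \<le> \<mu>\<close> W0[OF \<open>z0 \<in> \<Omega>\<close>] by (simp add: hz0)
    ultimately show False by linarith
  qed
  moreover have "ball z1 \<rho> \<subseteq> \<Omega>"
    using R by (auto simp: \<rho>_def)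
  ultimately show ?thesis using \<rho> by blast
qed

text \<open>The contact set is nonempty, relatively closed by continuity and open by
  \<open>contact_set_open\<close>, so it fills the connected domain.\<close>

lemma strong_maximum_principle:
  fixes z1 :: "real \<times> real"
  assumes "0 < lam" "lam \<le> Lam" "0 \<le> \<mu>" "open \<Omega>" "connected \<Omega>"
    and "continuous_on \<Omega> \<phi>" "visc_super lam Lam \<mu> \<Omega> \<phi>" "continuous_on \<Omega> v"
      "\<And>z. z \<in> \<Omega> \<Longrightarrow> \<exists>a b c. C2_hess_at v z a b c \<and> 0 \<le> pucci_plus lam Lam a b c + \<mu> * v z"
      "\<And>z. z \<in> \<Omega> \<Longrightarrow> v z \<le> \<phi> z"
    and z1: "z1 \<in> \<Omega>" "\<phi> z1 = v z1" and "z \<in> \<Omega>"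
  shows "\<phi> z = v z"
proof -
  define Z where "Z = {z \<in> \<Omega>. \<phi> z = v z}"
  have "open Z"
    unfolding open_contains_ball
  proof
    fix z assume "z \<in> Z"
    then have "\<exists>\<rho>>0. \<forall>y\<in>ball z \<rho>. y \<in> \<Omega> \<and> \<phi> y = v y"
      by (intro contact_set_open[OF assms(1-4,6-10)]) (auto simp: Z_def)
    then show "\<exists>\<rho>>0. ball z \<rho> \<subseteq> Z" by (auto simp: Z_def)
  qed
  then have "openin (top_of_set \<Omega>) Z"
    by (rule open_subset[rotated]) (auto simp: Z_def)
  moreover have "closedin (top_of_set \<Omega>) Z"
  proof -
    have "closedin (top_of_set \<Omega>) {z \<in> \<Omega>. \<phi> z - v z = 0}"
      using assms(6,8) by (intro continuous_closedin_preimage_constant continuous_intros)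
    then show ?thesis by (simp add: Z_def)
  qed
  ultimately have "Z = \<Omega>"
    using \<open>connected \<Omega>\<close> z1 unfolding connected_clopen by (auto simp: Z_def)
  then show ?thesis using \<open>z \<in> \<Omega>\<close> by (auto simp: Z_def)
qed

section \<open>The one-dimensional profile\<close>

text \<open>C1 gluing across a seam; applied to a profile and again to its derivative it yields C2
  regularity.\<close>

lemma DERIV_If_le:
  fixes F G :: "real \<Rightarrow> real"
  assumes F: "\<And>x. (F has_real_derivative F' x) (at x)" and G: "\<And>x. (G has_real_derivative G' x) (at x)"
    and eq: "F a = G a" "F' a = G' a"
  shows "((\<lambda>x. if x \<le> a then F x else G x) has_real_derivative (if x \<le> a then F' x else G' x)) (at x)"
proof -
  have "((\<lambda>x. if x \<in> {..a} then F x else G x) has_vector_derivative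
      (if x \<in> {..a} then F' x else G' x)) (at x within {..a} \<union> {a..})"
    by (rule has_vector_derivative_If_within_closures)
      (use F G eq in \<open>auto simp: has_real_derivative_iff_has_vector_derivative[symmetric]
          intro: has_field_derivative_at_within\<close>)
  moreover have "{..a} \<union> {a..} = UNIV" by auto
  ultimately show ?thesis
    by (simp add: has_real_derivative_iff_has_vector_derivative)
qed

text \<open>Three branches in \<open>t\<close>, rather than two in its absolute value, let the
  gluing lemmas act directly on nested case splits at the two seams; \<open>prof_abs\<close>
  recovers the even form.\<close>

definition prof :: "real \<Rightarrow> real \<Rightarrow> real" where
  "prof s t = (if t \<le> - (pi / 2) then - s * sin ((- t - pi / 2) / s)
     else if t \<le> pi / 2 then cos t else - s * sin ((t - pi / 2) / s))"

definition prof' :: "real \<Rightarrow> real \<Rightarrow> real" where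
  "prof' s t = (if t \<le> - (pi / 2) then cos ((- t - pi / 2) / s)
     else if t \<le> pi / 2 then - sin t else - cos ((t - pi / 2) / s))"

definition prof'' :: "real \<Rightarrow> real \<Rightarrow> real" where
  "prof'' s t = (if t \<le> - (pi / 2) then sin ((- t - pi / 2) / s) / s
     else if t \<le> pi / 2 then - cos t else sin ((t - pi / 2) / s) / s)"

lemma prof_DERIV:
  assumes "0 < s"
  shows "(prof s has_real_derivative prof' s t) (at t)"
  unfolding prof_def[abs_def] prof'_def
  by (intro DERIV_If_le) (use assms in \<open>auto intro!: derivative_eq_intros simp: field_simps\<close>)

text \<open>On each branch the second derivative is a multiple of the profile, which vanishes at the
  seams, so the one-sided second derivatives agree although the multiples differ.\<close>

lemma prof'_DERIV:
  assumes "0 < s"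
  shows "(prof' s has_real_derivative prof'' s t) (at t)"
  unfolding prof'_def[abs_def] prof''_def
  by (intro DERIV_If_le) (use assms in \<open>auto intro!: derivative_eq_intros simp: field_simps\<close>)

lemma continuous_on_If_le:
  fixes F G :: "real \<Rightarrow> real"
  assumes "continuous_on UNIV F" "continuous_on UNIV G" "F a = G a"
  shows "continuous_on UNIV (\<lambda>x. if x \<le> a then F x else G x)"
  using assms by (intro continuous_on_cases_le) (auto elim: continuous_on_subset)

lemma prof''_continuous:
  assumes "0 < s"
  shows "continuous_on UNIV (prof'' s)"
  unfolding prof''_def[abs_def]
  by (intro continuous_on_If_le continuous_intros) (use assms in auto)

lemma prof_continuous:
  assumes "0 < s"
  shows "continuous_on S (prof s)" "continuous_on S (prof' s)"
  by (meson assms prof_DERIV prof'_DERIV DERIV_isCont continuous_at_imp_continuous_on)+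

lemma prof_abs: "prof s t = (if \<bar>t\<bar> \<le> pi / 2 then cos t else - s * sin ((\<bar>t\<bar> - pi / 2) / s))"
proof -
  consider "t < - (pi / 2)" "t < 0" | "t = - (pi / 2)" | "- (pi / 2) < t" "t \<le> pi / 2"
    | "pi / 2 < t" "\<not> t \<le> - (pi / 2)" "\<not> t < 0"
    using pi_gt_zero by linarith
  then show ?thesis
    by cases (auto simp: prof_def abs_if)
qed

lemma prof_even: "prof s (- t) = prof s t"
  by (simp add: prof_abs)

lemma prof''_abs: "prof'' s t = (if \<bar>t\<bar> \<le> pi / 2 then - cos t else sin ((\<bar>t\<bar> - pi / 2) / s) / s)"
proof -
  consider "t < - (pi / 2)" "t < 0" | "t = - (pi / 2)" | "- (pi / 2) < t" "t \<le> pi / 2"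
    | "pi / 2 < t" "\<not> t \<le> - (pi / 2)" "\<not> t < 0"
    using pi_gt_zero by linarith
  then show ?thesis
    by cases (auto simp: prof''_def abs_if)
qed

lemma prof'_odd:
  assumes "0 < s"
  shows "prof' s (- t) = - prof' s t"
proof -
  have "((\<lambda>t. prof s (- t)) has_real_derivative prof' s (- t) * - 1) (at t)"
    by (rule DERIV_chain2[OF prof_DERIV[OF assms]]) (auto intro!: derivative_eq_intros)
  then have "(prof s has_real_derivative - prof' s (- t)) (at t)"
    by (simp add: prof_even)
  then show ?thesis
    using DERIV_unique[OF prof_DERIV[OF assms]] by (metis minus_minus)
qed

text \<open>A quarter period of the outer sine branch beyond \<pi>/2: the point where the profile
  reaches its minimum \<open>- s\<close> and stops decreasing.\<close>

definition prof_end :: "real \<Rightarrow> real" where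
  "prof_end s = pi / 2 + s * (pi / 2)"

lemma prof_end_gt: "0 < s \<Longrightarrow> pi / 2 < prof_end s"
  by (simp add: prof_end_def)

lemma prof_0 [simp]: "prof s 0 = 1"
  by (simp add: prof_abs)

lemma prof_at_end: "0 < s \<Longrightarrow> prof s (prof_end s) = - s"
  by (auto simp: prof_abs prof_end_def mult_le_0_iff) (use pi_gt_zero in linarith)

lemma prof'_neg:
  assumes "0 < s" "0 < t" "t < prof_end s"
  shows "prof' s t < 0"
proof (cases "t \<le> pi / 2")
  case True
  then have "0 < sin t" using assms by (intro sin_gt_zero) auto
  then show ?thesis using True assms by (simp add: prof'_def)
next
  case False
  then have "0 < (t - pi / 2) / s" "(t - pi / 2) / s < pi / 2"
    using assms by (auto simp: prof_end_def field_simps)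
  then have "0 < cos ((t - pi / 2) / s)"
    by (intro cos_gt_zero) auto
  moreover have "\<not> t \<le> - (pi / 2)" using assms pi_gt_zero by linarith
  ultimately show ?thesis using False by (simp add: prof'_def)
qed

lemma prof_strict_decreasing:
  assumes "0 < s" "0 \<le> t" "t < t'" "t' \<le> prof_end s"
  shows "prof s t' < prof s t"
proof (rule DERIV_neg_imp_decreasing_open[OF assms(3)])
  show "\<exists>y. (prof s has_real_derivative y) (at x) \<and> y < 0" if "t < x" "x < t'" for x
    using prof_DERIV[OF assms(1)] prof'_neg[OF assms(1), of x] that assms by auto
qed (rule prof_continuous[OF assms(1)])

lemma prof_decreasing_abs:
  assumes "0 < s" "\<bar>t\<bar> \<le> \<bar>t'\<bar>" "\<bar>t'\<bar> \<le> prof_end s"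
  shows "prof s t' \<le> prof s t"
proof -
  have "prof s \<bar>t'\<bar> \<le> prof s \<bar>t\<bar>"
    using prof_strict_decreasing[OF assms(1), of "\<bar>t\<bar>" "\<bar>t'\<bar>"] assms by (cases "\<bar>t\<bar> = \<bar>t'\<bar>") auto
  then show ?thesis by (simp add: abs_if prof_even split: if_splits)
qed

lemma prof_le_1:
  assumes "0 < s" "\<bar>t\<bar> \<le> prof_end s"
  shows "prof s t \<le> 1"
  using prof_decreasing_abs[OF assms(1) _ assms(2), of 0] by simp

lemma prof'_zero:
  assumes "0 < s" "\<bar>t\<bar> \<le> prof_end s" "prof' s t = 0"
  shows "t = 0 \<or> \<bar>t\<bar> = prof_end s"
proof (rule ccontr)
  assume "\<not> ?thesis"
  then have "0 < \<bar>t\<bar>" "\<bar>t\<bar> < prof_end s" using assms(2) by auto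
  from prof'_neg[OF assms(1) this] show False
    using assms(3) prof'_odd[OF assms(1), of t] by (cases "0 \<le> t") auto
qed

text \<open>On the inner branch the second derivative is nonpositive, selects the coefficient
  \<open>lam\<close> and equals minus the profile. On the outer branch it is positive, and the
  coefficient \<open>lam * s\<^sup>2\<close> cancels the factor \<open>1 / s\<^sup>2\<close>. The
  multiplier \<open>k\<close> covers both \<gamma> and 1.\<close>

lemma prof_ode:
  assumes "0 < s" "\<bar>t\<bar> \<le> prof_end s" "0 < k"
  shows "(if k * prof'' s t \<le> 0 then lam * (k * prof'' s t) else lam * s\<^sup>2 * (k * prof'' s t)) = - lam * (k * prof s t)"
proof (cases "\<bar>t\<bar> \<le> pi / 2")
  case True
  then have "0 \<le> cos t" by (intro cos_ge_zero) auto
  then have "k * - cos t \<le> 0" using assms by simp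
  then show ?thesis using True unfolding prof''_abs prof_abs by simp
next
  case False
  then have "0 < (\<bar>t\<bar> - pi / 2) / s" "(\<bar>t\<bar> - pi / 2) / s \<le> pi / 2"
    using assms by (auto simp: prof_end_def field_simps)
  then have "0 < sin ((\<bar>t\<bar> - pi / 2) / s)"
    by (intro sin_gt_zero) (use pi_gt_zero in linarith)+
  then have "0 < k * (sin ((\<bar>t\<bar> - pi / 2) / s) / s)" using assms by simp
  then have "\<not> k * (sin ((\<bar>t\<bar> - pi / 2) / s) / s) \<le> 0" by (simp only: not_le)
  then show ?thesis using False \<open>0 < s\<close>
    unfolding prof''_abs prof_abs by (simp only: if_False) (simp add: power2_eq_square)
qed

lemma prof_strict_decreasing_abs:
  assumes "0 < s" "\<bar>t\<bar> < \<bar>t'\<bar>" "\<bar>t'\<bar> \<le> prof_end s"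
  shows "prof s t' < prof s t"
proof -
  have "prof s \<bar>t'\<bar> < prof s \<bar>t\<bar>"
    using assms by (intro prof_strict_decreasing) auto
  then show ?thesis by (simp add: abs_if prof_even split: if_splits)
qed

lemma prof_nonneg_iff:
  assumes "0 < s" "\<bar>t\<bar> \<le> prof_end s"
  shows "0 \<le> prof s t \<longleftrightarrow> \<bar>t\<bar> \<le> pi / 2"
proof -
  have "prof s (pi / 2) = 0" by (simp add: prof_abs)
  then show ?thesis
    using prof_strict_decreasing_abs[OF assms(1) _ assms(2), of "pi / 2"]
      prof_decreasing_abs[OF assms(1), of t "pi / 2"] prof_end_gt[OF assms(1)] by fastforce
qed

lemma arcsin_unit_interval:
  assumes "0 \<le> c" "c \<le> 1"
  shows "0 \<le> arcsin c" "arcsin c \<le> pi / 2" "sin (arcsin c) = c"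
  using assms arcsin_le_arcsin[of 0 c] arcsin_bounded[of c] by auto

section \<open>The domain and its eigenvalue\<close>

text \<open>Here \<open>s\<close> is the square root of \<omega>, so the larger ellipticity constant
  is \<open>lam * s\<^sup>2\<close> and no radicals enter the computations.\<close>

locale pucci_domain =
  fixes lam s \<gamma> :: real
  assumes lam: "0 < lam" and s: "1 \<le> s" and \<gamma>_ge: "1 \<le> \<gamma> * s" and \<gamma>_le: "\<gamma> \<le> s"
begin

abbreviation Lam :: real where "Lam \<equiv> lam * s\<^sup>2"
abbreviation A :: real where "A \<equiv> prof_end s"

definition U :: "real \<times> real \<Rightarrow> real" where
  "U z = \<gamma> * prof s (fst z) + prof s (snd z)"

definition Om :: "(real \<times> real) set" where
  "Om = {z. \<bar>fst z\<bar> < A \<and> \<bar>snd z\<bar> < A \<and> 0 < U z}"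

text \<open>A compact set containing the closure of \<open>Om\<close>, given by closed inequalities
  so that the closure need not be computed.\<close>

definition Cl :: "(real \<times> real) set" where
  "Cl = {z. \<bar>fst z\<bar> \<le> A \<and> \<bar>snd z\<bar> \<le> A \<and> 0 \<le> U z}"

lemma s_pos: "0 < s" using s by simp

lemma abs_s: "\<bar>s\<bar> = s" using s by simp

lemma \<gamma>_pos: "0 < \<gamma>"
  using \<gamma>_ge s_pos by (smt (verit) mult_nonpos_nonneg)

lemma A_pos: "0 < A" using prof_end_gt[OF s_pos] pi_gt_zero by linarith

lemma lam_le_Lam: "lam \<le> Lam"
  using lam s by simp

lemma continuous_U: "continuous_on S U"
  unfolding U_def[abs_def]
  by (intro continuous_intros continuous_on_compose2[OF prof_continuous(1)[OF s_pos, of UNIV]]) auto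

lemma continuous_prof':
  "continuous_on S (\<lambda>z. prof' s (fst z))" "continuous_on S (\<lambda>z. prof' s (snd z))"
  by (intro continuous_on_compose2[OF prof_continuous(2)[OF s_pos, of UNIV]] continuous_intros subset_UNIV)+

lemma open_Om: "open Om"
proof -
  have "Om = {z. \<bar>fst z\<bar> < A} \<inter> {z. \<bar>snd z\<bar> < A} \<inter> {z. 0 < U z}"
    by (auto simp: Om_def)
  then show ?thesis
    by (auto intro!: open_Int open_Collect_less continuous_intros continuous_U)
qed

lemma closed_Cl: "closed Cl"
proof -
  have "Cl = {z. \<bar>fst z\<bar> \<le> A} \<inter> {z. \<bar>snd z\<bar> \<le> A} \<inter> {z. 0 \<le> U z}"
    by (auto simp: Cl_def)
  then show ?thesis
    by (auto intro!: closed_Int closed_Collect_le continuous_intros continuous_U)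
qed

lemma Om_subset_Cl: "Om \<subseteq> Cl"
  by (auto simp: Om_def Cl_def)

lemma closure_subset_Cl: "closure Om \<subseteq> Cl"
  by (rule closure_minimal[OF Om_subset_Cl closed_Cl])

lemma compact_Cl: "compact Cl"
proof -
  have "Cl \<subseteq> cbox (- A, - A) (A, A)"
    by (auto simp: Cl_def cbox_Pair_eq abs_le_iff)
  then show ?thesis
    using closed_Cl bounded_subset[OF bounded_cbox] by (auto simp: compact_eq_bounded_closed)
qed

lemma compact_closure_Om: "compact (closure Om)"
  using compact_Cl closure_subset_Cl by (meson closed_closure compact_eq_bounded_closed bounded_subset)

text \<open>On the vertical sides of the square \<open>U \<le> 1 - \<gamma> * s \<le> 0\<close>, and
  on the horizontal sides \<open>U \<le> \<gamma> - s \<le> 0\<close>. The two bounds on \<gamma>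
  thus keep the positivity set off the boundary of the square.\<close>

lemma Om_iff: "z \<in> Om \<longleftrightarrow> z \<in> Cl \<and> 0 < U z"
proof
  assume z: "z \<in> Cl \<and> 0 < U z"
  then have b: "\<bar>fst z\<bar> \<le> A" "\<bar>snd z\<bar> \<le> A" by (auto simp: Cl_def)
  have "\<bar>fst z\<bar> \<noteq> A"
  proof
    assume "\<bar>fst z\<bar> = A"
    then have "prof s (fst z) = - s"
      using prof_at_end[OF s_pos] prof_even[of s "fst z"] by (auto simp: abs_if split: if_splits)
    then show False
      using z prof_le_1[OF s_pos b(2)] \<gamma>_ge by (simp add: U_def)
  qed
  moreover have "\<bar>snd z\<bar> \<noteq> A"
  proof
    assume "\<bar>snd z\<bar> = A"
    then have "prof s (snd z) = - s"
      using prof_at_end[OF s_pos] prof_even[of s "snd z"] by (auto simp: abs_if split: if_splits)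
    moreover have "\<gamma> * prof s (fst z) \<le> \<gamma> * 1"
      using prof_le_1[OF s_pos b(1)] \<gamma>_pos by (intro mult_left_mono) auto
    ultimately show False
      using z \<gamma>_le by (simp add: U_def)
  qed
  ultimately show "z \<in> Om" using z b by (auto simp: Om_def)
qed (auto simp: Om_def Cl_def)

lemma frontier_Om:
  assumes "z \<in> frontier Om"
  shows "z \<in> Cl" "U z = 0"
proof -
  have "z \<in> closure Om" "z \<notin> Om"
    using assms open_Om by (auto simp: frontier_def interior_open)
  then show "z \<in> Cl" using closure_subset_Cl by blast
  then show "U z = 0" using Om_iff[of z] \<open>z \<notin> Om\<close> by (auto simp: Cl_def)
qed

text \<open>The profile decreases strictly in the absolute value of its argument up to
  \<open>A\<close>, so \<open>U\<close> increases strictly on moving towards the origin, where it is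
  positive. This is the strict star-shapedness.\<close>

lemma scaleR_Cl_in_Om:
  assumes "z \<in> Cl" "0 \<le> c" "c < 1"
  shows "c *\<^sub>R z \<in> Om"
proof -
  have b: "\<bar>fst z\<bar> \<le> A" "\<bar>snd z\<bar> \<le> A" "0 \<le> U z" using assms(1) by (auto simp: Cl_def)
  have le: "\<bar>c * t\<bar> \<le> \<bar>t\<bar>" for t
    using assms by (simp add: abs_mult mult_left_le_one_le)
  have lt: "\<bar>c * t\<bar> < \<bar>t\<bar>" if "t \<noteq> 0" for t
    using assms that by (simp add: abs_mult)
  have mono: "prof s t \<le> prof s (c * t)" if "\<bar>t\<bar> \<le> A" for t
    using prof_decreasing_abs[OF s_pos le that] .
  have strict: "prof s t < prof s (c * t)" if "\<bar>t\<bar> \<le> A" "t \<noteq> 0" for t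
    using prof_strict_decreasing_abs[OF s_pos lt[OF that(2)] that(1)] .
  have "0 < U (c *\<^sub>R z)"
  proof (cases "z = 0")
    case True
    then show ?thesis using \<gamma>_pos by (simp add: U_def)
  next
    case False
    then have "fst z \<noteq> 0 \<or> snd z \<noteq> 0" by (simp add: prod_eq_iff)
    then have "U z < U (c *\<^sub>R z)"
    proof
      assume "fst z \<noteq> 0"
      then have "\<gamma> * prof s (fst z) < \<gamma> * prof s (c * fst z)"
        using strict b(1) \<gamma>_pos by simp
      then show ?thesis using mono[OF b(2)] by (simp add: U_def)
    next
      assume "snd z \<noteq> 0"
      moreover have "\<gamma> * prof s (fst z) \<le> \<gamma> * prof s (c * fst z)"
        using mono[OF b(1)] \<gamma>_pos by simp
      ultimately show ?thesis using strict[OF b(2)] by (simp add: U_def)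
    qed
    then show ?thesis using b(3) by simp
  qed
  moreover have "c *\<^sub>R z \<in> Cl"
    using calculation b le[of "fst z"] le[of "snd z"] by (simp add: Cl_def)
  ultimately show ?thesis using Om_iff by blast
qed

lemma zero_in_Om: "0 \<in> Om"
  using A_pos \<gamma>_pos by (simp add: Om_def U_def)

lemma zero_in_Cl: "0 \<in> Cl"
  using zero_in_Om Om_subset_Cl by (rule subsetD[rotated])

lemma connected_Om: "connected Om"
proof (rule starlike_imp_connected)
  have "closed_segment 0 z \<subseteq> Om" if "z \<in> Om" for z
  proof
    fix w assume "w \<in> closed_segment 0 z"
    then obtain c where "0 \<le> c" "c \<le> 1" "w = c *\<^sub>R z"
      by (auto simp: closed_segment_def)
    then show "w \<in> Om"
      using scaleR_Cl_in_Om[of z c] that Om_subset_Cl by (cases "c = 1") auto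
  qed
  then show "starlike Om"
    unfolding starlike_def using zero_in_Om by blast
qed

lemma C2_U: "C2_hess_at U z (\<gamma> * prof'' s (fst z)) 0 (prof'' s (snd z))"
  unfolding U_def[abs_def]
  by (rule C2_hess_at_separated; rule prof_DERIV[OF s_pos] prof'_DERIV[OF s_pos] prof''_continuous[OF s_pos])

lemma C2_U_scaled:
  "C2_hess_at (\<lambda>z. U (R *\<^sub>R z)) z (R\<^sup>2 * (\<gamma> * prof'' s (R * fst z))) (R\<^sup>2 * 0) (R\<^sup>2 * prof'' s (R * snd z))"
proof -
  have 1: "((\<lambda>x. prof s (R * x)) has_real_derivative R * prof' s (R * x)) (at x)" for x
    by (rule DERIV_cong[OF DERIV_chain2[OF prof_DERIV[OF s_pos]]]) (auto intro!: derivative_eq_intros)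
  have 2: "((\<lambda>x. R * prof' s (R * x)) has_real_derivative R\<^sup>2 * prof'' s (R * x)) (at x)" for x
    by (rule DERIV_cong[OF DERIV_cmult[OF DERIV_chain2[OF prof'_DERIV[OF s_pos]]]])
      (auto intro!: derivative_eq_intros simp: power2_eq_square)
  have 3: "continuous_on UNIV (\<lambda>x. R\<^sup>2 * prof'' s (R * x))"
    by (intro continuous_intros continuous_on_compose2[OF prof''_continuous[OF s_pos]] subset_UNIV)
  show ?thesis
    using C2_hess_at_separated[OF 1 2 3 1 2 3, of \<gamma> z] unfolding U_def by (simp add: mult_ac)
qed

text \<open>The Hessian is diagonal, so the operator acts on each coordinate separately and the
  one-dimensional equation applies twice.\<close>

lemma pucci_U:
  assumes "z \<in> Cl"
  shows "pucci_plus lam Lam (\<gamma> * prof'' s (fst z)) 0 (prof'' s (snd z)) = - lam * U z"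
proof -
  have b: "\<bar>fst z\<bar> \<le> A" "\<bar>snd z\<bar> \<le> A" using assms by (auto simp: Cl_def)
  show ?thesis
    unfolding pucci_plus_diag[OF lam_le_Lam] prof_ode[OF s_pos b(1) \<gamma>_pos]
      prof_ode[OF s_pos b(2) zero_less_one, unfolded mult_1_left]
    by (simp add: U_def algebra_simps)
qed

lemma U_classical:
  assumes "z \<in> Om"
  shows "\<exists>a b c. C2_hess_at U z a b c \<and> pucci_plus lam Lam a b c + lam * U z = 0"
  using C2_U[of z] pucci_U[of z] assms Om_subset_Cl by (intro exI conjI) auto

section \<open>Upper bound for the principal eigenvalue\<close>

lemma eigenvalue_le_scaled:
  assumes \<phi>: "continuous_on Om \<phi>" "\<And>z. z \<in> Om \<Longrightarrow> 0 < \<phi> z" "visc_super lam Lam \<mu> Om \<phi>"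
    and R: "1 < R"
  shows "\<mu> \<le> R\<^sup>2 * lam"
proof -
  have in_Om: "(1 / R) *\<^sub>R z \<in> Om" if "z \<in> Cl" for z
    using that R by (intro scaleR_Cl_in_Om) auto
  \<comment> \<open>The quotient of U(R w) and \<phi>(w), written in the variable z = R w so that it
    lives on the compact set \<open>Cl\<close>. The reciprocal of its maximum is the largest
    multiple of the scaled function lying below \<phi>.\<close>
  define q where "q z = U z / \<phi> ((1 / R) *\<^sub>R z)" for z
  have "continuous_on Cl (\<lambda>z. \<phi> ((1 / R) *\<^sub>R z))"
    by (rule continuous_on_compose2[OF \<phi>(1)]) (use in_Om in \<open>auto intro!: continuous_intros\<close>)
  moreover have "\<phi> ((1 / R) *\<^sub>R z) \<noteq> 0" if "z \<in> Cl" for z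
    using \<phi>(2)[OF in_Om[OF that]] by simp
  ultimately have "continuous_on Cl q"
    unfolding q_def by (intro continuous_on_divide continuous_U) auto
  then obtain z1 where z1: "z1 \<in> Cl" "\<And>z. z \<in> Cl \<Longrightarrow> q z \<le> q z1"
    using continuous_attains_sup[OF compact_Cl, of q] zero_in_Cl by (metis empty_iff)
  have "0 < q 0"
    using \<phi>(2)[OF zero_in_Om] zero_in_Om by (simp add: q_def Om_def)
  then have qpos: "0 < q z1"
    using z1(2)[OF zero_in_Cl] by (rule less_le_trans)
  define w where "w = (1 / R) *\<^sub>R z1"
  have w: "w \<in> Om" unfolding w_def by (rule in_Om[OF z1(1)])
  have Rw: "R *\<^sub>R w = z1" using R by (simp add: w_def)
  have \<phi>w: "0 < \<phi> w" by (rule \<phi>(2)[OF w])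
  have qz1: "q z1 = U z1 / \<phi> w" by (simp add: q_def w_def)
  \<comment> \<open>A positive maximum forces the contact point into the open set where the scaled
    function is positive, so it is an admissible touching point.\<close>
  then have Uz1: "0 < U z1" using qpos \<phi>w by (simp add: zero_less_divide_iff)
  then have z1_Om: "z1 \<in> Om" using z1 Om_iff by blast
  define t where "t = 1 / q z1"
  have t: "0 < t" using qpos by (simp add: t_def)
  have touch: "t * U (R *\<^sub>R w) = \<phi> w"
    using Uz1 \<phi>w by (simp add: Rw t_def qz1)
  have "open ((\<lambda>z. R *\<^sub>R z) -` Om)"
    by (intro open_vimage open_Om continuous_intros)
  moreover have "w \<in> (\<lambda>z. R *\<^sub>R z) -` Om" using Rw z1_Om by simp
  ultimately have "\<forall>\<^sub>F z in at w. z \<in> (\<lambda>z. R *\<^sub>R z) -` Om"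
    by (rule eventually_at_in_open')
  then have ev: "\<forall>\<^sub>F z in at w. t * U (R *\<^sub>R z) \<le> \<phi> z"
  proof eventually_elim
    case (elim z)
    then have Rz: "R *\<^sub>R z \<in> Cl" using Om_subset_Cl by blast
    have eq: "(1 / R) *\<^sub>R R *\<^sub>R z = z" using R by simp
    have "0 < \<phi> z" using \<phi>(2)[OF in_Om[OF Rz]] eq by simp
    moreover have "U (R *\<^sub>R z) / \<phi> z \<le> q z1"
      using z1(2)[OF Rz] unfolding q_def eq by simp
    ultimately have "U (R *\<^sub>R z) \<le> q z1 * \<phi> z" by (simp add: pos_divide_le_eq)
    then show ?case using qpos by (simp add: t_def field_simps)
  qed
  have "C2_hess_at (\<lambda>z. t * U (R *\<^sub>R z)) w (t * (R\<^sup>2 * (\<gamma> * prof'' s (R * fst w))))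
      (t * (R\<^sup>2 * 0)) (t * (R\<^sup>2 * prof'' s (R * snd w)))"
    by (intro C2_hess_at_cmult C2_U_scaled)
  then have "pucci_plus lam Lam (t * (R\<^sup>2 * (\<gamma> * prof'' s (R * fst w))))
      (t * (R\<^sup>2 * 0)) (t * (R\<^sup>2 * prof'' s (R * snd w))) + \<mu> * \<phi> w \<le> 0"
    using \<phi>(3) w touch ev unfolding visc_super_def by metis
  moreover have "pucci_plus lam Lam (t * (R\<^sup>2 * (\<gamma> * prof'' s (R * fst w))))
      (t * (R\<^sup>2 * 0)) (t * (R\<^sup>2 * prof'' s (R * snd w))) = t * (R\<^sup>2 * (- lam * U z1))"
    unfolding pucci_plus_scale[OF lam_le_Lam less_imp_le[OF t]] pucci_plus_scale[OF lam_le_Lam zero_le_power2]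
    using pucci_U[OF z1(1)] by (simp flip: Rw)
  ultimately have "\<mu> * \<phi> w \<le> R\<^sup>2 * lam * \<phi> w"
    unfolding touch[symmetric] Rw by (simp add: mult_ac)
  then show ?thesis using \<phi>w by simp
qed

lemma eigenvalue_le:
  assumes "continuous_on Om \<phi>" "\<And>z. z \<in> Om \<Longrightarrow> 0 < \<phi> z" "visc_super lam Lam \<mu> Om \<phi>"
  shows "\<mu> \<le> lam"
proof (rule ccontr)
  assume "\<not> \<mu> \<le> lam"
  \<comment> \<open>Chosen so that \<open>R\<^sup>2 * lam\<close> is the midpoint of
    \<open>lam\<close> and \<mu>, strictly below \<mu>.\<close>
  define R where "R = sqrt ((\<mu> + lam) / (2 * lam))"
  have "1 < (\<mu> + lam) / (2 * lam)" using \<open>\<not> \<mu> \<le> lam\<close> lam by (simp add: field_simps)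
  then have "1 < R" "R\<^sup>2 * lam = (\<mu> + lam) / 2" using lam by (auto simp: R_def)
  then show False
    using eigenvalue_le_scaled[OF assms \<open>1 < R\<close>] \<open>\<not> \<mu> \<le> lam\<close> by simp
qed

lemma visc_super_U: "visc_super lam Lam lam Om U"
  by (rule classical_imp_visc_super[OF lam lam_le_Lam open_Om]) (use U_classical in force)+

lemma principal_eigenvalue_Om: "principal_eigenvalue lam Lam Om = lam"
  unfolding principal_eigenvalue_def
proof (rule cSup_eq_maximum)
  show "lam \<in> {\<mu>. \<exists>\<phi>. continuous_on Om \<phi> \<and> (\<forall>z\<in>Om. 0 < \<phi> z) \<and> visc_super lam Lam \<mu> Om \<phi>}"
    using continuous_U visc_super_U Om_iff by blast
qed (use eigenvalue_le in blast)

section \<open>Uniqueness of the eigenfunction\<close>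

text \<open>With this choice \<open>1 - B cosh (2t)\<close> is at least \<open>1/2\<close> on \<open>[- A, A]\<close>, while the sum of this function
  and its second derivative is \<open>- 3/2\<close> at \<open>\<plusminus> A\<close> and less than \<open>1\<close> everywhere.\<close>

definition B :: real where "B = 1 / (2 * cosh (2 * A))"

text \<open>The concave correction \<open>- U\<^sup>2\<close> gives strictness where the gradient of \<open>U\<close> does not vanish;
  the last term takes over at the corners of the domain where it does.\<close>

definition barrier :: "real \<Rightarrow> real \<times> real \<Rightarrow> real" where
  "barrier \<delta> z = U z - (U z)\<^sup>2 + \<delta> * (2 - B * (cosh (2 * fst z) + cosh (2 * snd z)))"

text \<open>An upper bound for the operator plus \<open>lam\<close> times the barrier, divided by
  \<open>lam\<close>. The term \<open>U\<^sup>2\<close> is what remains of -(1 - 2U)U + U -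
  \<open>U\<^sup>2\<close>; the factor 5 adds 4 from the second derivative of cosh(2t) to 1 from its
  value.\<close>

definition defect :: "real \<Rightarrow> real \<times> real \<Rightarrow> real" where
  "defect \<delta> z = (U z)\<^sup>2 - 2 * ((\<gamma> * prof' s (fst z))\<^sup>2 + (prof' s (snd z))\<^sup>2)
     + \<delta> * (2 - 5 * B * (cosh (2 * fst z) + cosh (2 * snd z)))"

lemma B_pos: "0 < B" by (simp add: B_def cosh_real_pos)

lemma B_cosh: "B * cosh (2 * A) = 1 / 2"
  using cosh_real_pos[of "2 * A"] by (simp add: B_def)

lemma B_cosh_le:
  assumes "\<bar>t\<bar> \<le> A"
  shows "B * cosh (2 * t) \<le> 1 / 2"
proof -
  have "cosh (2 * t) = cosh \<bar>2 * t\<bar>" by simp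
  also have "\<dots> \<le> cosh (2 * A)"
    using assms by (subst cosh_real_nonneg_le_iff) auto
  finally have "B * cosh (2 * t) \<le> B * cosh (2 * A)"
    using B_pos by simp
  then show ?thesis by (simp add: B_cosh)
qed

text \<open>For \<open>U\<close> between 0 and 1/2 the part \<open>U - U\<^sup>2\<close> is
  nonnegative, and the correction is at least \<delta> because each cosh term is at most
  1/2.\<close>

lemma barrier_pos:
  assumes "z \<in> Cl" "U z \<le> 1 / 2" "0 < \<delta>"
  shows "0 < barrier \<delta> z"
proof -
  have b: "\<bar>fst z\<bar> \<le> A" "\<bar>snd z\<bar> \<le> A" "0 \<le> U z" using assms(1) by (auto simp: Cl_def)
  have "U z * U z \<le> U z * 1" using b assms by (intro mult_left_mono) auto
  then have "0 \<le> U z - (U z)\<^sup>2" by (simp add: power2_eq_square)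
  moreover have "0 < 2 - B * (cosh (2 * fst z) + cosh (2 * snd z))"
    using B_cosh_le[OF b(1)] B_cosh_le[OF b(2)] by (simp add: algebra_simps)
  ultimately show ?thesis
    using assms(3) unfolding barrier_def by (simp add: add_nonneg_pos)
qed

lemma C2_barrier:
  "C2_hess_at (barrier \<delta>) z
    ((1 - 2 * U z) * (\<gamma> * prof'' s (fst z)) - 2 * (\<gamma> * prof' s (fst z))\<^sup>2 + \<delta> * (- 4 * B * cosh (2 * fst z)))
    (- 2 * (\<gamma> * prof' s (fst z)) * prof' s (snd z))
    ((1 - 2 * U z) * prof'' s (snd z) - 2 * (prof' s (snd z))\<^sup>2 + \<delta> * (- 4 * B * cosh (2 * snd z)))"
proof -
  note f = prof_DERIV[OF s_pos] prof'_DERIV[OF s_pos] prof''_continuous[OF s_pos]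
  have sq: "((\<lambda>x. (prof s x)\<^sup>2) has_real_derivative 2 * prof s x * prof' s x) (at x)"
    "((\<lambda>x. 2 * prof s x * prof' s x) has_real_derivative 2 * (prof' s x)\<^sup>2 + 2 * prof s x * prof'' s x) (at x)" for x
    by (auto intro!: derivative_eq_intros f simp: power2_eq_square algebra_simps)
  have sq_cont: "continuous_on UNIV (\<lambda>x. 2 * (prof' s x)\<^sup>2 + 2 * prof s x * prof'' s x)"
    by (intro continuous_intros f prof_continuous[OF s_pos])
  have ch: "((\<lambda>x. 1 - B * cosh (2 * x)) has_real_derivative - 2 * B * sinh (2 * x)) (at x)"
    "((\<lambda>x. - 2 * B * sinh (2 * x)) has_real_derivative - 4 * B * cosh (2 * x)) (at x)" for x
    by (auto intro!: derivative_eq_intros)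
  have ch_cont: "continuous_on UNIV (\<lambda>x. - 4 * B * cosh (2 * x))"
    by (intro continuous_intros)
  \<comment> \<open>The square of \<open>U\<close> is expanded into a separated sum and a mixed
    product, the two shapes with Hessian rules at hand.\<close>
  have "C2_hess_at (\<lambda>z. U z
      + (- 1) * ((\<gamma>\<^sup>2 * (prof s (fst z))\<^sup>2 + (prof s (snd z))\<^sup>2) + 2 * \<gamma> * (prof s (fst z) * prof s (snd z)))
      + \<delta> * (1 * (1 - B * cosh (2 * fst z)) + (1 - B * cosh (2 * snd z)))) z
    (\<gamma> * prof'' s (fst z)
      + (- 1) * (\<gamma>\<^sup>2 * (2 * (prof' s (fst z))\<^sup>2 + 2 * prof s (fst z) * prof'' s (fst z))
        + 2 * \<gamma> * (prof'' s (fst z) * prof s (snd z)))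
      + \<delta> * (1 * (- 4 * B * cosh (2 * fst z))))
    (0 + (- 1) * (0 + 2 * \<gamma> * (prof' s (fst z) * prof' s (snd z))) + \<delta> * 0)
    (prof'' s (snd z)
      + (- 1) * ((2 * (prof' s (snd z))\<^sup>2 + 2 * prof s (snd z) * prof'' s (snd z))
        + 2 * \<gamma> * (prof s (fst z) * prof'' s (snd z)))
      + \<delta> * (- 4 * B * cosh (2 * snd z)))"
    using C2_hess_at_prod[OF f f, of "fst z" "snd z"]
    by (intro C2_hess_at_add C2_hess_at_cmult C2_U
        C2_hess_at_separated[OF sq sq_cont sq sq_cont] C2_hess_at_separated[OF ch ch_cont ch ch_cont]) simp
  moreover have "(\<lambda>z. U z
      + (- 1) * ((\<gamma>\<^sup>2 * (prof s (fst z))\<^sup>2 + (prof s (snd z))\<^sup>2) + 2 * \<gamma> * (prof s (fst z) * prof s (snd z)))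
      + \<delta> * (1 * (1 - B * cosh (2 * fst z)) + (1 - B * cosh (2 * snd z)))) = barrier \<delta>"
    by (auto simp: barrier_def U_def power2_eq_square algebra_simps)
  ultimately show ?thesis
    by (simp add: U_def power2_eq_square algebra_simps)
qed

text \<open>Subadditivity splits the Hessian into 1 - 2U times that of \<open>U\<close>, minus twice
  the square of the gradient, and a negative diagonal part. The bound \<open>U z \<le> 1 / 2\<close>
  makes the first factor nonnegative, so homogeneity applies to it.\<close>

lemma barrier_strict:
  assumes "z \<in> Cl" "U z \<le> 1 / 2" "0 < \<delta>"
    "a = (1 - 2 * U z) * (\<gamma> * prof'' s (fst z)) - 2 * (\<gamma> * prof' s (fst z))\<^sup>2 + \<delta> * (- 4 * B * cosh (2 * fst z))"
    "b = - 2 * (\<gamma> * prof' s (fst z)) * prof' s (snd z)"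
    "c = (1 - 2 * U z) * prof'' s (snd z) - 2 * (prof' s (snd z))\<^sup>2 + \<delta> * (- 4 * B * cosh (2 * snd z))"
  shows "pucci_plus lam Lam a b c + lam * barrier \<delta> z \<le> lam * defect \<delta> z"
proof -
  let ?p = "\<gamma> * prof' s (fst z)" and ?q = "prof' s (snd z)"
  let ?t = "1 - 2 * U z"
  let ?d1 = "\<delta> * (- 4 * B * cosh (2 * fst z))" and ?d2 = "\<delta> * (- 4 * B * cosh (2 * snd z))"
  let ?P = "pucci_plus lam Lam"
  note add = pucci_plus_add[OF lam_le_Lam]
  have t: "0 \<le> ?t" using assms(2) by simp
  have "?P a b c = ?P (?t * (\<gamma> * prof'' s (fst z)) + (- 2 * ?p\<^sup>2 + ?d1))
      (?t * 0 + (- 2 * ?p * ?q + 0)) (?t * prof'' s (snd z) + (- 2 * ?q\<^sup>2 + ?d2))"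
    unfolding assms(4-6) by (simp add: algebra_simps)
  also have "\<dots> \<le> ?P (?t * (\<gamma> * prof'' s (fst z))) (?t * 0) (?t * prof'' s (snd z))
      + ?P (- 2 * ?p\<^sup>2 + ?d1) (- 2 * ?p * ?q + 0) (- 2 * ?q\<^sup>2 + ?d2)"
    by (rule add)
  also have "\<dots> \<le> ?P (?t * (\<gamma> * prof'' s (fst z))) (?t * 0) (?t * prof'' s (snd z))
      + (?P (- 2 * ?p\<^sup>2) (- 2 * ?p * ?q) (- 2 * ?q\<^sup>2) + ?P ?d1 0 ?d2)"
    using add[of "- 2 * ?p\<^sup>2" ?d1 "- 2 * ?p * ?q" 0 "- 2 * ?q\<^sup>2" ?d2] by simp
  also have "?P (?t * (\<gamma> * prof'' s (fst z))) (?t * 0) (?t * prof'' s (snd z)) = ?t * (- lam * U z)"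
    unfolding pucci_plus_scale[OF lam_le_Lam t] pucci_U[OF assms(1)] ..
  also have "?P (- 2 * ?p\<^sup>2) (- 2 * ?p * ?q) (- 2 * ?q\<^sup>2) = - lam * 2 * (?p\<^sup>2 + ?q\<^sup>2)"
    by (rule pucci_plus_minus_rank_one[OF lam_le_Lam]) simp
  also have "?P ?d1 0 ?d2 = lam * (?d1 + ?d2)"
  proof -
    have "?d1 \<le> 0" "?d2 \<le> 0"
      using assms(3) B_pos cosh_real_nonneg by (auto simp: mult_le_0_iff zero_le_mult_iff)
    then show ?thesis
      unfolding pucci_plus_diag[OF lam_le_Lam] by (simp add: algebra_simps)
  qed
  finally show ?thesis
    unfolding barrier_def defect_def by (simp add: power2_eq_square algebra_simps)
qed

text \<open>A vanishing gradient forces each coordinate to be 0 or \<plusminus>A, and both cannot be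
  0 because \<open>U\<close> vanishes on the frontier. One coordinate at \<plusminus>A already
  contributes 5/2 > 2.\<close>

lemma corner_term_neg_of_gradient_zero:
  assumes "z \<in> frontier Om" "prof' s (fst z) = 0" "prof' s (snd z) = 0"
  shows "2 - 5 * B * (cosh (2 * fst z) + cosh (2 * snd z)) < 0"
proof -
  have z: "z \<in> Cl" "U z = 0" using frontier_Om[OF assms(1)] by auto
  then have "\<bar>fst z\<bar> \<le> A" "\<bar>snd z\<bar> \<le> A" by (auto simp: Cl_def)
  then have "fst z = 0 \<or> \<bar>fst z\<bar> = A" "snd z = 0 \<or> \<bar>snd z\<bar> = A"
    using prof'_zero[OF s_pos] assms by auto
  moreover have "\<not> (fst z = 0 \<and> snd z = 0)"
    using z(2) \<gamma>_pos by (auto simp: U_def)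
  ultimately have "\<bar>fst z\<bar> = A \<or> \<bar>snd z\<bar> = A" by blast
  moreover have half: "B * cosh (2 * t) = 1 / 2" if "\<bar>t\<bar> = A" for t
  proof -
    have "cosh (2 * t) = cosh \<bar>2 * t\<bar>" by simp
    also have "\<dots> = cosh (2 * A)" using that by (simp add: abs_mult)
    finally show ?thesis by (simp only: B_cosh)
  qed
  moreover have "0 < B * cosh (2 * t)" for t
    using B_pos by (simp add: cosh_real_pos)
  note this[of "fst z"] this[of "snd z"]
  moreover have "5 * B * (cosh (2 * fst z) + cosh (2 * snd z))
      = 5 * (B * cosh (2 * fst z)) + 5 * (B * cosh (2 * snd z))"
    by (simp add: algebra_simps)
  ultimately show ?thesis
    using half[of "fst z"] half[of "snd z"] by linarith
qed

lemma continuous_defect: "continuous_on S (defect \<delta>)"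
  unfolding defect_def[abs_def]
  by (intro continuous_intros continuous_U continuous_prof')

text \<open>On the frontier the defect is -2D + \<delta>G. On the compact part where
  \<open>G\<close> is nonnegative the squared gradient \<open>D\<close> has a lower bound d > 0, and
  \<delta> = d/2 suffices because G < 2; elsewhere on the frontier \<open>G\<close> is
  negative.\<close>

lemma exists_defect_negative_on_frontier:
  "\<exists>\<delta>>0. \<forall>z\<in>frontier Om. defect \<delta> z < 0"
proof -
  define G where "G = (\<lambda>z. 2 - 5 * B * (cosh (2 * fst z) + cosh (2 * snd z)))"
  define D where "D = (\<lambda>z. (\<gamma> * prof' s (fst z))\<^sup>2 + (prof' s (snd z))\<^sup>2)"
  define S where "S = {z \<in> frontier Om. 0 \<le> G z}"
  have cont: "continuous_on T G" "continuous_on T D" for T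
    unfolding G_def D_def by (intro continuous_intros continuous_prof')+
  have S_Int: "S = frontier Om \<inter> {z. 0 \<le> G z}" by (auto simp: S_def)
  have "closed {z. 0 \<le> G z}"
    by (intro closed_Collect_le continuous_intros cont)
  then have "compact S"
    unfolding S_Int using compact_closure_Om
    by (intro compact_Int_closed compact_frontier_bounded) (auto intro: bounded_subset[OF compact_imp_bounded closure_subset])
  have defect_eq: "defect \<delta> z = - 2 * D z + \<delta> * G z" if "z \<in> frontier Om" for z \<delta>
    using frontier_Om(2)[OF that] by (simp add: defect_def D_def G_def)
  have D_pos: "0 < D z" if "z \<in> S" for z
  proof -
    have "prof' s (fst z) \<noteq> 0 \<or> prof' s (snd z) \<noteq> 0"
      using corner_term_neg_of_gradient_zero[of z] that by (auto simp: S_def G_def)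
    then show ?thesis
      using \<gamma>_pos by (auto simp: D_def add_pos_nonneg add_nonneg_pos)
  qed
  have D_nonneg: "0 \<le> D z" for z by (simp add: D_def)
  obtain d where d: "0 < d" "\<And>z. z \<in> S \<Longrightarrow> d \<le> D z"
  proof (cases "S = {}")
    case True
    then show ?thesis using that[of 1] by simp
  next
    case False
    then obtain y where "y \<in> S" "\<And>z. z \<in> S \<Longrightarrow> D y \<le> D z"
      using continuous_attains_inf[OF \<open>compact S\<close> False cont(2)] by blast
    then show ?thesis using that[of "D y"] D_pos by blast
  qed
  have "defect (d / 2) z < 0" if z: "z \<in> frontier Om" for z
  proof (cases "z \<in> S")
    case True
    have "G z < 2"
      using B_pos cosh_real_pos by (simp add: G_def add_pos_pos)
    then have "d / 2 * G z < d / 2 * 2" using d(1) by simp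
    then show ?thesis using d(2)[OF True] d(1) defect_eq[OF z, of "d / 2"] by linarith
  next
    case False
    then have "G z < 0" using z by (auto simp: S_def)
    then have "d / 2 * G z < 0" using d(1) by (simp add: mult_pos_neg)
    then show ?thesis using defect_eq[OF z, of "d / 2"] D_nonneg[of z] by simp
  qed
  then show ?thesis using d(1) by (intro exI[of _ "d / 2"]) auto
qed

lemma supersolution_multiple_of_U:
  assumes cont: "continuous_on (closure Om) \<phi>" and pos: "\<And>z. z \<in> Om \<Longrightarrow> 0 < \<phi> z"
    and bd: "\<And>z. z \<in> frontier Om \<Longrightarrow> \<phi> z = 0"
    and super: "visc_super lam Lam lam Om \<phi>"
  shows "\<exists>t>0. \<forall>z\<in>closure Om. \<phi> z = t * U z"
proof -
  obtain \<delta> where \<delta>: "0 < \<delta>" and neg: "\<And>z. z \<in> frontier Om \<Longrightarrow> defect \<delta> z < 0"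
    using exists_defect_negative_on_frontier by blast
  have clos: "closure Om = Om \<union> frontier Om"
    using open_Om by (auto simp: frontier_def interior_open closure_subset[THEN subsetD])
  have contOm: "continuous_on Om \<phi>"
    using cont closure_subset by (rule continuous_on_subset)
  \<comment> \<open>On the frontier \<open>U\<close> is 0 and the defect is negative, so
    \<open>K\<close> is a compact subset of the open set. Off \<open>K\<close> the barrier is a
    positive strict supersolution.\<close>
  define K where "K = {z \<in> closure Om. 0 \<le> defect \<delta> z \<or> 1 / 2 \<le> U z}"
  have "K = closure Om \<inter> ({z. 0 \<le> defect \<delta> z} \<union> {z. 1 / 2 \<le> U z})"
    by (auto simp: K_def)
  then have "compact K"
    by (auto intro!: compact_Int_closed compact_closure_Om closed_Un closed_Collect_le continuous_intros
        continuous_U continuous_defect)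
  have K_Om: "K \<subseteq> Om"
    using neg frontier_Om(2) by (force simp: K_def clos)
  have "0 \<in> K"
    using zero_in_Om \<gamma>_pos by (simp add: K_def U_def closure_subset[THEN subsetD])
  have U_pos: "0 < U z" if "z \<in> Om" for z using that Om_iff by blast
  have "continuous_on K (\<lambda>z. \<phi> z / U z)"
  proof (intro continuous_on_divide continuous_U)
    show "continuous_on K \<phi>" using contOm K_Om by (rule continuous_on_subset)
    show "\<forall>z\<in>K. U z \<noteq> 0" using U_pos K_Om by fastforce
  qed
  then obtain z1 where z1: "z1 \<in> K" "\<And>z. z \<in> K \<Longrightarrow> \<phi> z1 / U z1 \<le> \<phi> z / U z"
    using continuous_attains_inf[OF \<open>compact K\<close>] \<open>0 \<in> K\<close> by blast
  define t where "t = \<phi> z1 / U z1"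
  have z1_Om: "z1 \<in> Om" using z1 K_Om by blast
  have t: "0 < t" using pos[OF z1_Om] U_pos[OF z1_Om] by (simp add: t_def)
  have K_le: "t * U z \<le> \<phi> z" if "z \<in> K" for z
    using z1(2)[OF that] U_pos[of z] K_Om that unfolding t_def[symmetric] by (auto simp: pos_le_divide_eq)
  have le: "t * U z \<le> \<phi> z" if "z \<in> Om" for z
  proof (rule ccontr)
    assume gt: "\<not> t * U z \<le> \<phi> z"
    \<comment> \<open>A closed region on which the barrier is positive, so the quotient below is
      defined up to the frontier; it contains every point of the domain outside
      \<open>K\<close>.\<close>
    define E where "E = {z \<in> closure Om. U z \<le> 1 / 2}"
    have "E = closure Om \<inter> {z. U z \<le> 1 / 2}" by (auto simp: E_def)
    then have "compact E"
      by (auto intro!: compact_Int_closed compact_closure_Om closed_Collect_le continuous_intros continuous_U)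
    have zE: "z \<in> E"
      using gt K_le[of z] that closure_subset by (force simp: K_def E_def)
    have bpos: "0 < barrier \<delta> y" if "y \<in> E" for y
      using that closure_subset_Cl \<delta> by (intro barrier_pos) (auto simp: E_def)
    define q where "q y = (t * U y - \<phi> y) / barrier \<delta> y" for y
    have "continuous_on E q"
      unfolding q_def
    proof (intro continuous_on_divide continuous_on_diff continuous_on_mult continuous_on_const continuous_U)
      show "continuous_on E \<phi>" using cont by (rule continuous_on_subset) (auto simp: E_def)
      show "continuous_on E (barrier \<delta>)"
        unfolding barrier_def[abs_def] by (intro continuous_intros continuous_U)
      show "\<forall>y\<in>E. barrier \<delta> y \<noteq> 0" using bpos by force
    qed
    then obtain z0 where z0: "z0 \<in> E" "\<And>y. y \<in> E \<Longrightarrow> q y \<le> q z0"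
      using continuous_attains_sup[OF \<open>compact E\<close>] zE by blast
    \<comment> \<open>The least multiple of the barrier whose subtraction brings
      \<open>t * U\<close> below \<phi> on \<open>E\<close>; it is positive because the inequality
      fails at \<open>z\<close>.\<close>
    define M where "M = q z0"
    have "0 < q z" using gt bpos[OF zE] by (simp add: q_def)
    then have M: "0 < M" using z0(2)[OF zE] by (simp add: M_def)
    then have num: "\<phi> z0 < t * U z0"
      using bpos[OF z0(1)] by (simp add: M_def q_def zero_less_divide_iff)
    \<comment> \<open>The contact point avoids the frontier, where both functions vanish, and avoids
      \<open>K\<close>, where the inequality holds by the choice of \<open>t\<close>. The strict
      barrier inequality is therefore available there.\<close>
    have "z0 \<notin> frontier Om"
      using num bd[of z0] frontier_Om(2)[of z0] by auto
    then have z0_Om: "z0 \<in> Om" using z0(1) clos by (auto simp: E_def)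
    have z0K: "z0 \<notin> K" using num K_le[of z0] by auto
    then have z0': "defect \<delta> z0 < 0" "U z0 < 1 / 2"
      using z0(1) by (auto simp: K_def E_def)
    have below: "t * U y - M * barrier \<delta> y \<le> \<phi> y" if "y \<in> E" for y
    proof -
      have "(t * U y - \<phi> y) / barrier \<delta> y \<le> M"
        using z0(2)[OF that] by (simp only: M_def q_def)
      then show ?thesis by (simp add: pos_divide_le_eq[OF bpos[OF that]] algebra_simps)
    qed
    have "open (Om \<inter> {y. U y < 1 / 2})"
      by (intro open_Int open_Om open_Collect_less continuous_intros continuous_U)
    moreover have "z0 \<in> Om \<inter> {y. U y < 1 / 2}" using z0_Om z0' by simp
    ultimately have "\<forall>\<^sub>F y in at z0. y \<in> Om \<inter> {y. U y < 1 / 2}"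
      by (rule eventually_at_in_open')
    then have ev: "\<forall>\<^sub>F y in at z0. t * U y - M * barrier \<delta> y \<le> \<phi> y"
    proof eventually_elim
      case (elim y)
      then show ?case using closure_subset by (intro below) (auto simp: E_def)
    qed
    have touch: "\<phi> z0 = t * U z0 - M * barrier \<delta> z0"
      using bpos[OF z0(1)] by (simp add: M_def q_def)
    obtain a b c where U2: "C2_hess_at U z0 a b c" "pucci_plus lam Lam a b c + lam * U z0 = 0"
      using U_classical[OF z0_Om] by blast
    have sub: "0 \<le> pucci_plus lam Lam (t * a) (t * b) (t * c) + lam * (t * U z0)"
    proof -
      have "pucci_plus lam Lam (t * a) (t * b) (t * c) + lam * (t * U z0)
          = t * (pucci_plus lam Lam a b c + lam * U z0)"
        unfolding pucci_plus_scale[OF lam_le_Lam less_imp_le[OF t]] by (simp add: algebra_simps)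
      then show ?thesis using U2(2) by simp
    qed
    obtain a' b' c' where h2: "C2_hess_at (barrier \<delta>) z0 a' b' c'"
      "pucci_plus lam Lam a' b' c' + lam * barrier \<delta> z0 \<le> lam * defect \<delta> z0"
      using C2_barrier barrier_strict[OF _ _ \<delta> refl refl refl] z0' z0_Om Om_subset_Cl
      by (meson less_imp_le subsetD)
    have "0 \<le> pucci_plus lam Lam (M * a') (M * b') (M * c') + lam * (M * barrier \<delta> z0)"
      by (rule visc_super_touch[OF lam_le_Lam super z0_Om C2_hess_at_cmult[OF U2(1)] sub
            C2_hess_at_cmult[OF h2(1)] touch ev])
    also have "\<dots> = M * (pucci_plus lam Lam a' b' c' + lam * barrier \<delta> z0)"
      unfolding pucci_plus_scale[OF lam_le_Lam less_imp_le[OF M]] by (simp add: algebra_simps)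
    also have "\<dots> \<le> M * (lam * defect \<delta> z0)"
      using M h2(2) by simp
    also have "\<dots> < 0"
      using M lam z0'(1) by (simp add: mult_pos_neg)
    finally show False by simp
  qed
  have eq: "\<phi> z = t * U z" if "z \<in> Om" for z
  proof (rule strong_maximum_principle[OF lam lam_le_Lam less_imp_le[OF lam] open_Om connected_Om contOm super])
    show "continuous_on Om (\<lambda>z. t * U z)" by (intro continuous_intros continuous_U)
    show "\<exists>a b c. C2_hess_at (\<lambda>z. t * U z) z a b c \<and> 0 \<le> pucci_plus lam Lam a b c + lam * (t * U z)"
      if z: "z \<in> Om" for z
    proof -
      obtain a b c where U2: "C2_hess_at U z a b c" "pucci_plus lam Lam a b c + lam * U z = 0"
        using U_classical[OF z] by blast
      have "pucci_plus lam Lam (t * a) (t * b) (t * c) + lam * (t * U z)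
          = t * (pucci_plus lam Lam a b c + lam * U z)"
        unfolding pucci_plus_scale[OF lam_le_Lam less_imp_le[OF t]] by (simp add: algebra_simps)
      then show ?thesis using C2_hess_at_cmult[OF U2(1), of t] U2(2) by (metis mult_zero_right order_refl)
    qed
    show "\<phi> z1 = t * U z1" using U_pos[OF z1_Om] by (simp add: t_def)
  qed (use le z1_Om that in auto)
  have "\<phi> z = t * U z" if "z \<in> closure Om" for z
    using that eq[of z] bd[of z] frontier_Om(2)[of z] unfolding clos by auto
  then show ?thesis using t by blast
qed

section \<open>Identification with the explicit formulas\<close>

text \<open>The shifted cosines are minus sines, so only the choice of branch matters. If x lies
  beyond \<pi>/2, its term is nonpositive, and \<open>0 \<le> U z\<close> then forces y into the
  inner range, where the formula has the plain cosine.\<close>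

lemma u_eig_eq:
  assumes "z \<in> Cl"
  shows "u_eig (s\<^sup>2) \<gamma> z = U z"
proof -
  obtain x y where z: "z = (x, y)" by (cases z)
  have b: "\<bar>x\<bar> \<le> A" "\<bar>y\<bar> \<le> A" "0 \<le> \<gamma> * prof s x + prof s y"
    using assms by (auto simp: Cl_def U_def z)
  have cs: "cos (t + pi / 2) = - sin t" for t :: real by (simp add: cos_add)
  consider "\<bar>x\<bar> \<le> pi / 2" "\<bar>y\<bar> \<le> pi / 2" | "pi / 2 \<le> \<bar>x\<bar>" "\<not> (\<bar>x\<bar> \<le> pi / 2 \<and> \<bar>y\<bar> \<le> pi / 2)"
    | "\<bar>x\<bar> < pi / 2" "pi / 2 < \<bar>y\<bar>" by linarith
  then show ?thesis
  proof cases
    case 1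
    then show ?thesis by (simp add: z u_eig_def U_def prof_abs)
  next
    case 2
    have "\<bar>y\<bar> \<le> pi / 2"
    proof -
      have "prof s x \<le> 0"
        using prof_decreasing_abs[OF s_pos, of "pi / 2" x] 2 b by (simp add: prof_abs[of s "pi / 2"])
      then have "\<gamma> * prof s x \<le> 0" using \<gamma>_pos by (simp add: mult_le_0_iff)
      then have "0 \<le> prof s y" using b(3) by linarith
      then show ?thesis using prof_nonneg_iff[OF s_pos b(2)] by simp
    qed
    then have "\<not> \<bar>x\<bar> \<le> pi / 2" using 2 by blast
    then show ?thesis
      using 2 \<open>\<bar>y\<bar> \<le> pi / 2\<close> by (simp add: z u_eig_def U_def prof_abs abs_s cs)
  next
    case 3
    then show ?thesis by (simp add: z u_eig_def U_def prof_abs abs_s cs)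
  qed
qed

text \<open>For fixed x the condition \<open>0 < U\<close> is solved for the absolute value of y: by
  monotonicity of sine on the outer branch of y when x is inner, and by monotonicity of cosine when
  x is outer.\<close>

lemma Omega_dom_eq: "Omega_dom (s\<^sup>2) \<gamma> = Om"
proof -
  have gs: "0 < \<gamma> * s" using \<gamma>_pos s_pos by simp
  have arg1: "0 \<le> 1 / (\<gamma> * s)" "1 / (\<gamma> * s) \<le> 1" using \<gamma>_ge gs by auto
  have "(x, y) \<in> Omega_dom (s\<^sup>2) \<gamma> \<longleftrightarrow> (x, y) \<in> Om" for x y
  proof (cases "\<bar>x\<bar> \<le> pi / 2")
    case True
    have cx: "0 \<le> cos x" using True by (intro cos_ge_zero) auto
    define c where "c = \<gamma> / s * cos x"
    have c0: "0 \<le> c" using cx \<gamma>_pos s_pos by (simp add: c_def)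
    have c1: "c \<le> 1"
    proof -
      have "\<gamma> / s \<le> 1" "0 \<le> \<gamma> / s" using \<gamma>_le \<gamma>_pos s_pos by auto
      then show ?thesis unfolding c_def using cos_le_one[of x] cx mult_le_one by blast
    qed
    note asin = arcsin_unit_interval[OF c0 c1]
    have xA: "\<bar>x\<bar> < A" "\<bar>x\<bar> \<le> phi_bound (s\<^sup>2) \<gamma>"
    proof -
      show "\<bar>x\<bar> < A" using True prof_end_gt[OF s_pos] by linarith
      have "0 \<le> s * arcsin (1 / (\<gamma> * s))" using s_pos arcsin_unit_interval(1)[OF arg1] by simp
      then show "\<bar>x\<bar> \<le> phi_bound (s\<^sup>2) \<gamma>" using True by (simp add: phi_bound_def abs_s)
    qed
    have prof_x: "prof s x = cos x" using True by (simp add: prof_abs)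
    have "\<bar>y\<bar> < pi / 2 + s * arcsin c \<longleftrightarrow> \<bar>y\<bar> < A \<and> 0 < \<gamma> * cos x + prof s y"
    proof (cases "\<bar>y\<bar> \<le> pi / 2")
      case y: True
      have "\<bar>y\<bar> < A" using y prof_end_gt[OF s_pos] by linarith
      have py: "prof s y = cos y" using y by (simp add: prof_abs)
      show ?thesis
      \<comment> \<open>On the seam of x the section is exactly the interval between -\<pi>/2 and
        \<pi>/2. Otherwise the x-term is positive and every inner y belongs to both sets, the
        endpoints \<plusminus>\<pi>/2 included.\<close>
      proof (cases "cos x = 0")
        case True
        then have "c = 0" by (simp add: c_def)
        moreover have "\<bar>y\<bar> < pi / 2 \<longleftrightarrow> 0 < cos y"
        proof
          assume "\<bar>y\<bar> < pi / 2"
          then show "0 < cos y" by (intro cos_gt_zero_pi) auto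
        next
          assume "0 < cos y"
          then have "0 < cos \<bar>y\<bar>" by simp
          then have "\<bar>y\<bar> \<noteq> pi / 2" by (metis cos_pi_half less_irrefl)
          then show "\<bar>y\<bar> < pi / 2" using y by simp
        qed
        ultimately show ?thesis
          using \<open>\<bar>y\<bar> < A\<close> py True by simp
      next
        case False
        then have "0 < c" using cx \<gamma>_pos s_pos by (simp add: c_def)
        then have "0 < arcsin c" using arcsin_less_arcsin[of 0 c] c1 by simp
        then have "0 < s * arcsin c" using s_pos by simp
        moreover have "0 < \<gamma> * cos x" using False cx \<gamma>_pos by simp
        moreover have "0 \<le> cos y" using y by (intro cos_ge_zero) auto
        ultimately show ?thesis using y py \<open>\<bar>y\<bar> < A\<close> by auto
      qed
    next
      case y: False
      define \<theta> where "\<theta> = (\<bar>y\<bar> - pi / 2) / s"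
      have \<theta>: "0 < \<theta>" "\<bar>y\<bar> = pi / 2 + s * \<theta>" using y s_pos by (auto simp: \<theta>_def)
      have yA: "\<bar>y\<bar> < A \<longleftrightarrow> \<theta> < pi / 2"
        using \<theta>(2) s_pos by (simp add: prof_end_def)
      have py: "prof s y = - s * sin \<theta>" using y by (simp add: prof_abs \<theta>_def)
      have "\<bar>y\<bar> < pi / 2 + s * arcsin c \<longleftrightarrow> \<theta> < arcsin c"
        using \<theta>(2) s_pos by simp
      also have "\<dots> \<longleftrightarrow> \<theta> < pi / 2 \<and> sin \<theta> < c"
      proof
        assume "\<theta> < arcsin c"
        then show "\<theta> < pi / 2 \<and> sin \<theta> < c"
          using asin sin_monotone_2pi[of \<theta> "arcsin c"] \<theta>(1) by auto
      next
        assume *: "\<theta> < pi / 2 \<and> sin \<theta> < c"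
        show "\<theta> < arcsin c"
        proof (rule ccontr)
          assume "\<not> \<theta> < arcsin c"
          then have "sin (arcsin c) \<le> sin \<theta>"
            using * asin \<theta>(1) by (intro sin_monotone_2pi_le) auto
          then show False using * asin by simp
        qed
      qed
      also have "sin \<theta> < c \<longleftrightarrow> 0 < \<gamma> * cos x + prof s y"
        using s_pos by (simp add: c_def py field_simps)
      finally show ?thesis using yA by simp
    qed
    then show ?thesis
      using xA True by (simp add: Omega_dom_def phi_prof_def Om_def U_def abs_s prof_x c_def)
  next
    case False
    define \<theta> where "\<theta> = (\<bar>x\<bar> - pi / 2) / s"
    have \<theta>: "0 < \<theta>" "\<bar>x\<bar> = pi / 2 + s * \<theta>" using False s_pos by (auto simp: \<theta>_def)
    have px: "prof s x = - s * sin \<theta>" using False by (simp add: prof_abs \<theta>_def)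
    define c where "c = \<gamma> * s * sin \<theta>"
    have prof: "phi_prof (s\<^sup>2) \<gamma> x = arccos c" using False by (simp add: phi_prof_def abs_s c_def \<theta>_def)
    note asin = arcsin_unit_interval[OF arg1]
    have bound: "\<bar>x\<bar> \<le> phi_bound (s\<^sup>2) \<gamma> \<longleftrightarrow> \<theta> \<le> arcsin (1 / (\<gamma> * s))"
      using \<theta>(2) s_pos by (simp add: phi_bound_def abs_s)
    have xA: "\<bar>x\<bar> < A \<longleftrightarrow> \<theta> < pi / 2"
      using \<theta>(2) s_pos by (simp add: prof_end_def)
    show ?thesis
    proof
      assume "(x, y) \<in> Omega_dom (s\<^sup>2) \<gamma>"
      then have \<theta>1: "\<theta> \<le> arcsin (1 / (\<gamma> * s))" and y: "\<bar>y\<bar> < arccos c"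
        by (auto simp: Omega_dom_def bound prof)
      have "sin \<theta> \<le> 1 / (\<gamma> * s)"
        using sin_monotone_2pi_le[of \<theta> "arcsin (1 / (\<gamma> * s))"] \<theta>1 \<theta>(1) asin by simp
      then have c1: "c \<le> 1" using gs by (simp add: c_def field_simps)
      have "0 < sin \<theta>" using \<theta>(1) \<theta>1 asin(2) pi_gt_zero by (intro sin_gt_zero) linarith+
      then have c0: "0 < c" using gs by (simp add: c_def)
      have ac: "arccos c \<le> pi / 2" "cos (arccos c) = c" "arccos c \<le> pi"
        using c0 c1 arccos_le_pi2[of c] arccos_bounded[of c] by auto
      have cy: "c < cos y"
      proof -
        have "cos (arccos c) < cos \<bar>y\<bar>"
          using y ac by (intro cos_monotone_0_pi) auto
        then show ?thesis using ac(2) by simp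
      qed
      have y2: "\<bar>y\<bar> < pi / 2" using y ac by linarith
      then have py: "prof s y = cos y" by (simp add: prof_abs)
      \<comment> \<open>\<open>Omega_dom\<close> includes the endpoint \<open>phi_bound\<close>,
        which equals \<open>A\<close> when \<open>\<gamma> * s = 1\<close>. There \<open>c\<close>
        would be at least 1, leaving no y in the section.\<close>
      have "\<theta> \<noteq> pi / 2"
      proof
        assume "\<theta> = pi / 2"
        then have "sin \<theta> = 1" by (simp only: sin_pi_half)
        then have "1 \<le> c" using \<gamma>_ge by (simp add: c_def)
        then show False using cy cos_le_one[of y] by linarith
      qed
      then have "\<bar>x\<bar> < A" using xA \<theta>1 asin(2) by linarith
      moreover have "\<bar>y\<bar> < A" using y2 prof_end_gt[OF s_pos] by linarith
      moreover have "0 < U (x, y)" using cy by (simp add: U_def px py c_def)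
      ultimately show "(x, y) \<in> Om" by (simp add: Om_def)
    next
      assume "(x, y) \<in> Om"
      then have th: "\<theta> < pi / 2" and yA: "\<bar>y\<bar> < A" and U: "c < prof s y"
        using xA by (auto simp: Om_def U_def px c_def)
      have "0 < sin \<theta>" using \<theta>(1) th pi_gt_zero by (intro sin_gt_zero) linarith+
      then have c0: "0 < c" using gs by (simp add: c_def)
      then have y2: "\<bar>y\<bar> \<le> pi / 2"
        using U prof_nonneg_iff[OF s_pos less_imp_le[OF yA]] by simp
      then have cy: "c < cos y" using U by (simp add: prof_abs)
      then have c1: "c < 1" using cos_le_one[of y] by linarith
      have "\<bar>y\<bar> < arccos c"
      proof (rule ccontr)
        assume "\<not> \<bar>y\<bar> < arccos c"
        then have "cos \<bar>y\<bar> \<le> cos (arccos c)"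
          using y2 c0 c1 arccos_bounded[of c] pi_gt_zero by (intro cos_monotone_0_pi_le) linarith+
        then show False using cy c0 c1 by simp
      qed
      moreover have "\<theta> \<le> arcsin (1 / (\<gamma> * s))"
      proof (rule ccontr)
        assume "\<not> \<theta> \<le> arcsin (1 / (\<gamma> * s))"
        then have "sin (arcsin (1 / (\<gamma> * s))) \<le> sin \<theta>"
          using asin th by (intro sin_monotone_2pi_le) linarith+
        then have "1 \<le> c" using asin(3) gs by (simp add: c_def field_simps)
        then show False using c1 by simp
      qed
      ultimately show "(x, y) \<in> Omega_dom (s\<^sup>2) \<gamma>"
        by (simp add: Omega_dom_def bound prof)
    qed
  qed
  then show ?thesis by auto
qed

lemma principal_eigenfunction_u_eig: "principal_eigenfunction lam Lam Om (u_eig (s\<^sup>2) \<gamma>)"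
  unfolding principal_eigenfunction_def principal_eigenvalue_Om
proof (intro conjI ballI)
  have "continuous_on (closure Om) U" by (rule continuous_U)
  then show "continuous_on (closure Om) (u_eig (s\<^sup>2) \<gamma>)"
    using u_eig_eq closure_subset_Cl by (subst continuous_on_cong[OF refl]) auto
  show "0 < u_eig (s\<^sup>2) \<gamma> z" if "z \<in> Om" for z
    using that Om_iff u_eig_eq by simp
  show "u_eig (s\<^sup>2) \<gamma> z = 0" if "z \<in> frontier Om" for z
    using frontier_Om[OF that] u_eig_eq by simp
  show "visc_super lam Lam lam Om (u_eig (s\<^sup>2) \<gamma>)"
  proof (rule classical_imp_visc_super[OF lam lam_le_Lam open_Om])
    show "\<exists>a b c. C2_hess_at U z a b c \<and> pucci_plus lam Lam a b c + lam * U z \<le> 0" if "z \<in> Om" for z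
      using U_classical[OF that] by force
  qed (use u_eig_eq Om_subset_Cl in blast)
  show "visc_sub lam Lam lam Om (u_eig (s\<^sup>2) \<gamma>)"
  proof (rule classical_imp_visc_sub[OF lam lam_le_Lam open_Om])
    show "\<exists>a b c. C2_hess_at U z a b c \<and> 0 \<le> pucci_plus lam Lam a b c + lam * U z" if "z \<in> Om" for z
      using U_classical[OF that] by force
  qed (use u_eig_eq Om_subset_Cl in blast)
qed

lemma principal_eigenfunction_unique:
  assumes "principal_eigenfunction lam Lam Om \<phi>"
  shows "\<exists>t>0. \<forall>z\<in>closure Om. \<phi> z = t * u_eig (s\<^sup>2) \<gamma> z"
proof -
  have "\<exists>t>0. \<forall>z\<in>closure Om. \<phi> z = t * U z"
    using assms unfolding principal_eigenfunction_def principal_eigenvalue_Om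
    by (intro supersolution_multiple_of_U) auto
  then show ?thesis
    using u_eig_eq closure_subset_Cl by (metis subsetD)
qed

end

theorem theorem2p2:
  fixes lam Lam \<omega> \<gamma> :: real
  assumes "0 < lam" and "lam \<le> Lam"
    and "\<omega> = Lam / lam"
    and "1 / sqrt \<omega> \<le> \<gamma>" and "\<gamma> \<le> sqrt \<omega>"
  shows "principal_eigenvalue lam Lam (Omega_dom \<omega> \<gamma>) = lam
       \<and> principal_eigenfunction lam Lam (Omega_dom \<omega> \<gamma>) (u_eig \<omega> \<gamma>)
       \<and> (\<forall>\<phi>. principal_eigenfunction lam Lam (Omega_dom \<omega> \<gamma>) \<phi> \<longrightarrow>
             (\<exists>t>0. \<forall>z\<in>closure (Omega_dom \<omega> \<gamma>). \<phi> z = t * u_eig \<omega> \<gamma> z))"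
proof -
  have \<omega>: "1 \<le> \<omega>" using assms by simp
  then have sq: "(sqrt \<omega>)\<^sup>2 = \<omega>" by simp
  interpret pucci_domain lam "sqrt \<omega>" \<gamma>
  proof
    show "1 \<le> \<gamma> * sqrt \<omega>" using assms(4) \<omega> by (simp add: divide_le_eq split: if_splits)
  qed (use assms \<omega> in auto)
  have "lam * (sqrt \<omega>)\<^sup>2 = Lam" using assms by (simp add: sq)
  then show ?thesis
    using principal_eigenvalue_Om principal_eigenfunction_u_eig principal_eigenfunction_unique
    unfolding Omega_dom_eq[unfolded sq, symmetric] sq by simp
qed

end
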